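(* Let $P \subset \mathbb{R}^3$ be a centrally symmetric convex polytope all of whose facets are centrally symmetric, let $k$ be a positive integer, and let $\Lambda$ be a discrete multiset of points in $\mathbb{R}^3$ such that $\sum_{\lambda \in \Lambda} \mathbf{1}_{P+\lambda}(x) = k$ for almost every $x \in \mathbb{R}^3$. Let $\delta_\Lambda = \sum_{\lambda\in\Lambda}\delta_\lambda$ (counted with multiplicity). Then $$\operatorname{supp}\widehat{\delta_\Lambda} \subseteq \{0\} \cup \bigcap_{(\mathbf{e},\vec{\tau}_1,\vec{\tau}_2)} \Big( \mathbb{H}_{-0}(\mathbf{e}) \cup \mathbb{H}(\vec{\tau}_1) \cup \mathbb{H}(\vec{\tau}_2) \Big),$$ where the intersection is over all 4-legged frames $(\mathbf{e},\vec{\tau}_1,\vec{\tau}_2)$ of $P$.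
   Context: $\delta_\Lambda$ is a tempered distribution (since $\Lambda$ has bounded density) and $\widehat{\delta_\Lambda}$ denotes its distributional Fourier transform, with convention $\hat f(\boldsymbol{\xi}) = \int f(\mathbf{x}) e^{-2\pi i\langle \boldsymbol{\xi},\mathbf{x}\rangle}d\mathbf{x}$; $\operatorname{supp}$ is the support of a distribution. For a facet $F$ of a centrally symmetric polytope $P$, the opposite face $F^-$ is the reflection of $F$ through the center of $P$. A 4-legged frame of $P$ is a triple of vectors $(\mathbf{e},\vec{\tau}_1,\vec{\tau}_2)$ such that for some point $p$ the four segments $p+[\mathbf{e}]$, $p+[\mathbf{e}]+\vec{\tau}_1$, $p+[\mathbf{e}]+\vec{\tau}_2$, $p+[\mathbf{e}]+\vec{\tau}_1+\vec{\tau}_2$ are edges of $P$, the first two lie in a common facet $F$ of $P$ and the last two lie in the opposite facet $F^-$; here $[\mathbf{e}]$ is the segment from $0$ to $\mathbf{e}$. For a nonzero vector $\mathbf{x}$, $\mathbf{x}^* = \mathbf{x}/|\mathbf{x}|^2$, $\mathbf{x}^\perp$ is the plane through $0$ orthogonal to $\mathbf{x}$, $\mathbb{H}(\mathbf{x}) = \mathbb{Z}\mathbf{x}^* + \mathbf{x}^\perp$ and $\mathbb{H}_{-0}(\mathbf{x}) = (\mathbb{Z}\setminus\{0\})\mathbf{x}^* + \mathbf{x}^\perp$. *)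

theory Defs
  imports "HOL-Analysis.Analysis"
begin

subsection \<open>Central symmetry and 4-legged frames\<close>

definition symmetric_about :: "'a::real_vector \<Rightarrow> 'a set \<Rightarrow> bool" where
  "symmetric_about c S \<longleftrightarrow> (\<lambda>x. 2 *\<^sub>R c - x) ` S = S"

definition centrally_symmetric :: "'a::real_vector set \<Rightarrow> bool" where
  "centrally_symmetric S \<longleftrightarrow> (\<exists>c. symmetric_about c S)"

definition opposite_face :: "'a::real_vector \<Rightarrow> 'a set \<Rightarrow> 'a set" where
  "opposite_face c F = (\<lambda>x. 2 *\<^sub>R c - x) ` F"

text \<open>The center \<open>c\<close> below is unique when \<open>P\<close> is bounded and nonempty. Being an edge forces
  \<open>e \<noteq> 0\<close>.\<close>

definition four_legged_frame :: "'a::euclidean_space set \<Rightarrow> 'a \<Rightarrow> 'a \<Rightarrow> 'a \<Rightarrow> bool" where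
  "four_legged_frame P e \<tau>\<^sub>1 \<tau>\<^sub>2 \<longleftrightarrow>
     (\<exists>p c F. symmetric_about c P \<and> F facet_of P \<and>
        closed_segment p (p + e) edge_of P \<and>
        closed_segment (p + \<tau>\<^sub>1) (p + e + \<tau>\<^sub>1) edge_of P \<and>
        closed_segment (p + \<tau>\<^sub>2) (p + e + \<tau>\<^sub>2) edge_of P \<and>
        closed_segment (p + \<tau>\<^sub>1 + \<tau>\<^sub>2) (p + e + \<tau>\<^sub>1 + \<tau>\<^sub>2) edge_of P \<and>
        closed_segment p (p + e) \<subseteq> F \<and>
        closed_segment (p + \<tau>\<^sub>1) (p + e + \<tau>\<^sub>1) \<subseteq> F \<and>
        closed_segment (p + \<tau>\<^sub>2) (p + e + \<tau>\<^sub>2) \<subseteq> opposite_face c F \<and>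
        closed_segment (p + \<tau>\<^sub>1 + \<tau>\<^sub>2) (p + e + \<tau>\<^sub>1 + \<tau>\<^sub>2) \<subseteq> opposite_face c F)"

text \<open>The sets \<open>\<int>x\<^sup>* + x\<^sup>\<bottom>\<close> and \<open>(\<int> - {0})x\<^sup>* + x\<^sup>\<bottom>\<close>. The mathematics uses them only for
  \<open>x \<noteq> 0\<close>. For \<open>x = 0\<close> both are the whole space, so a degenerate frame with \<open>\<tau>\<^sub>1 = 0\<close> or
  \<open>\<tau>\<^sub>2 = 0\<close> imposes no condition.\<close>

definition dual_vec :: "'a::real_inner \<Rightarrow> 'a" where
  "dual_vec x = x /\<^sub>R (norm x)\<^sup>2"

definition hyperplanes :: "'a::real_inner \<Rightarrow> 'a set" where
  "hyperplanes x = {n *\<^sub>R dual_vec x + y | n y. n \<in> \<int> \<and> x \<bullet> y = 0}"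

definition hyperplanes_nz :: "'a::real_inner \<Rightarrow> 'a set" where
  "hyperplanes_nz x = {n *\<^sub>R dual_vec x + y | n y. n \<in> \<int> - {0} \<and> x \<bullet> y = 0}"

subsection \<open>Multiple tilings\<close>

text \<open>A multiset of points is given by its multiplicity function \<open>m\<close>. The sum over its points is
  taken in the extended nonnegative reals, where every family is summable.\<close>

definition multi_tiles :: "'a::euclidean_space set \<Rightarrow> nat \<Rightarrow> ('a \<Rightarrow> nat) \<Rightarrow> bool" where
  "multi_tiles P k m \<longleftrightarrow>
     (AE x in lborel. (\<Sum>\<^sub>\<infinity>l. of_nat (m l) * indicator ((+) l ` P) x) = (of_nat k :: ennreal))"

subsection \<open>Distributions\<close>

fun iterated_partial ::
  "'a::euclidean_space list \<Rightarrow> ('a \<Rightarrow> 'b::real_normed_vector) \<Rightarrow> 'a \<Rightarrow> 'b" where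
  "iterated_partial [] f = f"
| "iterated_partial (b # bs) f = (\<lambda>x. frechet_derivative (iterated_partial bs f) (at x) b)"

text \<open>\<open>C\<^sup>\<infinity>\<close>: total differentiability of all iterated partial derivatives also makes them
  continuous.\<close>

definition smooth :: "('a::euclidean_space \<Rightarrow> 'b::real_normed_vector) \<Rightarrow> bool" where
  "smooth f \<longleftrightarrow> (\<forall>bs x. set bs \<subseteq> Basis \<longrightarrow> iterated_partial bs f differentiable (at x))"

definition test_function_on :: "'a::euclidean_space set \<Rightarrow> ('a \<Rightarrow> complex) \<Rightarrow> bool" where
  "test_function_on U \<phi> \<longleftrightarrow>
     smooth \<phi> \<and> compact (closure {x. \<phi> x \<noteq> 0}) \<and> closure {x. \<phi> x \<noteq> 0} \<subseteq> U"

definition fourier :: "('a::euclidean_space \<Rightarrow> complex) \<Rightarrow> 'a \<Rightarrow> complex" where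
  "fourier \<phi> \<xi> = (LINT x|lborel. \<phi> x * exp (- (2 * of_real pi * \<i> * of_real (\<xi> \<bullet> x))))"

text \<open>A tempered distribution is represented by its action on test functions; a functional defined
  on all functions is only ever meaningful on Schwartz functions. The Fourier transform of a
  distribution is defined by duality.\<close>

definition fourier_dist ::
  "(('a::euclidean_space \<Rightarrow> complex) \<Rightarrow> complex) \<Rightarrow> ('a \<Rightarrow> complex) \<Rightarrow> complex" where
  "fourier_dist T \<phi> = T (fourier \<phi>)"

definition support_dist :: "(('a::euclidean_space \<Rightarrow> complex) \<Rightarrow> complex) \<Rightarrow> 'a set" where
  "support_dist T = - \<Union>{U. open U \<and> (\<forall>\<phi>. test_function_on U \<phi> \<longrightarrow> T \<phi> = 0)}"

text \<open>For \<open>m\<close> of bounded density the series converges absolutely on every Schwartz function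
  \<open>\<phi>\<close>. This covers every multiple tiling by a bounded set of positive measure.\<close>

definition delta_dist :: "('a::euclidean_space \<Rightarrow> nat) \<Rightarrow> ('a \<Rightarrow> complex) \<Rightarrow> complex" where
  "delta_dist m \<phi> = (\<Sum>\<^sub>\<infinity>l. of_nat (m l) * \<phi> l)"

end

(* The multiplicity function of the tiling is locally constant off the facets. At a generic point of
   a line parallel to a leg e of the frame, every translate of P looks like a product of a planar cone
   with that line. In this plane, take the second difference of the indicator functions in the
   in-facet direction v (at scale a) and the facet normal n (at scale b), with b much smaller than a:
   it isolates the four legs, with signs + - - +, whereas the second difference of the constant k is 0.
   So the signed length measure mu of the frame satisfies mu * delta_Lambda = 0. The Fourier transform
   of mu is a smooth symbol g that vanishes exactly on the set in the theorem, so a test function phi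
   supported where g is nonzero is psi * g with psi again a test function, and pairing phi with the
   transform of delta_Lambda gives (mu * delta_Lambda)(hat psi) = 0. *)

theory Submission
  imports Defs "HOL-Complex_Analysis.Complex_Analysis" "HOL-Probability.Sinc_Integral"
begin

subsection \<open>Smooth functions\<close>

text \<open>The tiling identity holds only almost everywhere and the legs are null sets, so nothing
  can be read off on a leg itself; the identity is used at shifted points off the bounding planes,
  where the count is locally constant. Letting \<open>b\<close> tend to 0 before \<open>a\<close>
  makes the shifts lexicographic: a plane through the point that \<open>v\<close> crosses is decided
  by \<open>v\<close> and drops out of the difference in \<open>n\<close>, and the planes that
  contain \<open>e\<close> and \<open>v\<close> are those orthogonal to \<open>n\<close>. Inside
  such a facet the difference in \<open>v\<close> vanishes too, except on the two extreme edges.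
  Legs of different translates may overlap on a line, and the cancellation holds only between all
  segments of one line, at almost every parameter. The sum over \<open>\<Lambda>\<close> must
  therefore be regrouped by lines and exchanged with integration. Absolute convergence comes from
  one integrable weight, which up to constants dominates transforms of test functions and is
  summable over \<open>\<Lambda>\<close>. Each factor of the symbol accounts for one family of
  planes: \<open>1 - exp (-2\<pi>\<i>t)\<close> vanishes at all integers \<open>t\<close>, the
  transform of a unit segment only at the nonzero ones.\<close>

lemma smooth_coinduct:
  fixes X :: "('a::euclidean_space \<Rightarrow> 'b::real_normed_vector) set"
  assumes "f \<in> X"
    and diff: "\<And>h x. h \<in> X \<Longrightarrow> h differentiable (at x)"
    and step: "\<And>h b. h \<in> X \<Longrightarrow> b \<in> Basis \<Longrightarrow> (\<lambda>x. frechet_derivative h (at x) b) \<in> X"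
  shows "smooth f"
proof -
  have "iterated_partial bs f \<in> X" if "set bs \<subseteq> Basis" for bs
    using that by (induction bs) (use assms in auto)
  then show ?thesis
    unfolding smooth_def using diff by blast
qed

lemma smooth_differentiable: "smooth f \<Longrightarrow> f differentiable (at x)"
  unfolding smooth_def by (metis empty_subsetI iterated_partial.simps(1) list.set(1))

lemma smooth_has_derivative: "smooth f \<Longrightarrow> (f has_derivative frechet_derivative f (at x)) (at x)"
  using smooth_differentiable frechet_derivative_works by blast

lemma smooth_partial:
  assumes "smooth f" "b \<in> Basis"
  shows "smooth (\<lambda>x. frechet_derivative f (at x) b)"
proof -
  \<comment> \<open>\<open>iterated_partial\<close> differentiates along the last entry of its list
    first, so the extra derivative is appended at the end.\<close>
  have eq: "iterated_partial bs (\<lambda>x. frechet_derivative f (at x) b) = iterated_partial (bs @ [b]) f" for bs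
    by (induction bs) auto
  show ?thesis
    unfolding smooth_def eq
    using assms by (auto simp: smooth_def)
qed

lemma smooth_continuous_on: "smooth f \<Longrightarrow> continuous_on A f"
  by (intro continuous_at_imp_continuous_on ballI differentiable_imp_continuous_within
      smooth_differentiable)

lemma smooth_add:
  assumes "smooth f" "smooth g"
  shows "smooth (\<lambda>x. f x + g x)"
proof (rule smooth_coinduct[of _ "{\<lambda>x. f x + g x | f g. smooth f \<and> smooth g}"])
  show "(\<lambda>x. f x + g x) \<in> {\<lambda>x. f x + g x | f g. smooth f \<and> smooth g}"
    using assms by blast
next
  fix h :: "'a \<Rightarrow> 'b" and x
  assume "h \<in> {\<lambda>x. f x + g x | f g. smooth f \<and> smooth g}"
  then show "h differentiable (at x)"
    by (auto intro: differentiable_add smooth_differentiable)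
next
  fix h :: "'a \<Rightarrow> 'b" and b :: 'a
  assume "h \<in> {\<lambda>x. f x + g x | f g. smooth f \<and> smooth g}" and b: "b \<in> Basis"
  then obtain f g where h: "h = (\<lambda>x. f x + g x)" "smooth f" "smooth g"
    by blast
  have d: "(h has_derivative
      (\<lambda>y. frechet_derivative f (at x) y + frechet_derivative g (at x) y)) (at x)" for x
    unfolding h(1) by (intro has_derivative_add smooth_has_derivative h)
  show "(\<lambda>x. frechet_derivative h (at x) b) \<in> {\<lambda>x. f x + g x | f g. smooth f \<and> smooth g}"
    unfolding frechet_derivative_at[OF d, symmetric] mem_Collect_eq
    by (rule exI[of _ "\<lambda>x. frechet_derivative f (at x) b"],
        rule exI[of _ "\<lambda>x. frechet_derivative g (at x) b"])
      (auto intro: smooth_partial b h)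
qed

text \<open>A partial derivative of a product is a sum of products, so the coinduction for \<open>smooth_mult\<close>
  needs the closure under sums.\<close>

inductive_set smooth_products :: "('a::euclidean_space \<Rightarrow> complex) set" where
  mult: "smooth f \<Longrightarrow> smooth g \<Longrightarrow> (\<lambda>x. f x * g x) \<in> smooth_products"
| add: "f \<in> smooth_products \<Longrightarrow> g \<in> smooth_products \<Longrightarrow> (\<lambda>x. f x + g x) \<in> smooth_products"

lemma smooth_products_step:
  assumes "h \<in> smooth_products"
  shows "(\<forall>x. h differentiable (at x)) \<and>
    (\<forall>b\<in>Basis. (\<lambda>x. frechet_derivative h (at x) b) \<in> smooth_products)"
  using assms
proof induction
  case (mult f g)
  have d: "((\<lambda>x. f x * g x) has_derivative
      (\<lambda>h. f x * frechet_derivative g (at x) h + frechet_derivative f (at x) h * g x)) (at x)" for x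
    by (intro has_derivative_mult smooth_has_derivative mult)
  show ?case
    unfolding frechet_derivative_at[OF d, symmetric]
    using d mult by (auto intro!: smooth_products.intros smooth_partial simp: differentiable_def)
next
  case (add f g)
  then have d: "((\<lambda>x. f x + g x) has_derivative
      (\<lambda>h. frechet_derivative f (at x) h + frechet_derivative g (at x) h)) (at x)" for x
    by (intro has_derivative_add) (auto simp: frechet_derivative_works)
  show ?case
    unfolding frechet_derivative_at[OF d, symmetric]
    using d add by (auto intro!: smooth_products.add simp: differentiable_def)
qed

lemma smooth_mult:
  fixes f g :: "'a::euclidean_space \<Rightarrow> complex"
  assumes "smooth f" "smooth g"
  shows "smooth (\<lambda>x. f x * g x)"
  by (rule smooth_coinduct[of _ smooth_products])
    (use assms smooth_products_step smooth_products.mult in blast)+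

text \<open>The chain rule replaces \<open>h\<close> by \<open>deriv h\<close> times the constant
  \<open>b \<bullet> a\<close>, which is again entire, so these functions form a class closed under
  partial derivatives. Characters and all factors of the frame symbol are of this form.\<close>

lemma smooth_entire:
  fixes a :: "'a::euclidean_space"
  assumes "h holomorphic_on UNIV"
  shows "smooth (\<lambda>x. h (of_real (x \<bullet> a)))"
proof -
  let ?X = "{\<lambda>x. h (of_real (x \<bullet> a)) | h. h holomorphic_on UNIV}"
  have d: "((\<lambda>x. h (of_real (x \<bullet> a))) has_derivative
      (\<lambda>y. deriv h (of_real (x \<bullet> a)) * of_real (y \<bullet> a))) (at x)"
    if "h holomorphic_on UNIV" for h and x :: 'a
  proof -
    have "((\<lambda>x. of_real (x \<bullet> a) :: complex) has_derivative (\<lambda>y. of_real (y \<bullet> a))) (at x)"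
      by (auto intro!: derivative_eq_intros)
    moreover have "(h has_derivative (*) (deriv h (of_real (x \<bullet> a)))) (at (of_real (x \<bullet> a)))"
      using that holomorphic_derivI[of h UNIV] has_field_derivative_def by blast
    ultimately show ?thesis
      by (rule has_derivative_compose)
  qed
  show ?thesis
  proof (rule smooth_coinduct[of _ ?X])
    show "(\<lambda>x. h (of_real (x \<bullet> a))) \<in> ?X"
      using assms by blast
  next
    fix f and x :: 'a assume "f \<in> ?X"
    then show "f differentiable (at x)"
      using d by (auto simp: differentiable_def)
  next
    fix f and b :: 'a assume "f \<in> ?X"
    then obtain h where h: "h holomorphic_on UNIV" "f = (\<lambda>x. h (of_real (x \<bullet> a)))"
      by blast
    have "(\<lambda>z. deriv h z * of_real (b \<bullet> a)) holomorphic_on UNIV"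
      by (intro holomorphic_intros h holomorphic_deriv) auto
    then show "(\<lambda>x. frechet_derivative f (at x) b) \<in> ?X"
      unfolding h(2) frechet_derivative_at[OF d[OF h(1)], symmetric] mem_Collect_eq
      by (intro exI[of _ "\<lambda>z. deriv h z * of_real (b \<bullet> a)"] conjI refl)
  qed
qed

lemma smooth_const: "smooth (\<lambda>x::'a::euclidean_space. c::complex)"
  using smooth_entire[of "\<lambda>_. c" 0] by simp

lemma has_derivative_zero_outside:
  assumes "closed K" "\<And>y. y \<notin> K \<Longrightarrow> f y = 0" "x \<notin> K"
  shows "(f has_derivative (\<lambda>_. 0)) (at x)"
proof -
  have "((\<lambda>_. 0) has_derivative (\<lambda>_. 0)) (at x)"
    by simp
  then show ?thesis
    by (rule has_derivative_transform_within_open[of _ _ _ _ "-K"]) (use assms in auto)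
qed

text \<open>The quotients \<open>v / g ^ j\<close> with \<open>v\<close> smooth and vanishing off
  \<open>K\<close> are closed under partial derivatives: the quotient rule raises \<open>j\<close>
  by one. Off the closed set \<open>K\<close> the numerator is 0 on an open set, so the quotient is
  0 there even where \<open>g\<close> vanishes.\<close>

lemma smooth_divide:
  fixes u g :: "'a::euclidean_space \<Rightarrow> complex"
  assumes "smooth u" "smooth g" and nz: "\<And>x. x \<in> closure {x. u x \<noteq> 0} \<Longrightarrow> g x \<noteq> 0"
  shows "smooth (\<lambda>x. u x / g x)"
proof -
  define K where "K = closure {x. u x \<noteq> 0}"
  define X where "X = {(\<lambda>x. v x / g x ^ j) | v j. smooth v \<and> {x. v x \<noteq> 0} \<subseteq> K}"
  have [simp]: "closed K"
    by (simp add: K_def)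
  have d: "((\<lambda>x. v x / g x ^ j) has_derivative
      (\<lambda>h. (frechet_derivative v (at x) h * g x - of_nat j * v x * frechet_derivative g (at x) h)
            / g x ^ Suc j)) (at x)"
    if v: "smooth v" "{x. v x \<noteq> 0} \<subseteq> K" for v j x
  proof (cases "x \<in> K")
    case True
    then have gx: "g x \<noteq> 0"
      using nz K_def by blast
    have "((\<lambda>x. v x / g x ^ j) has_derivative
      (\<lambda>h. (frechet_derivative v (at x) h * g x ^ j
          - v x * (of_nat j * frechet_derivative g (at x) h * g x ^ (j - 1))) / (g x ^ j * g x ^ j)))
      (at x)"
      by (rule has_derivative_eq_rhs, rule has_derivative_divide'[OF smooth_has_derivative
            has_derivative_power[OF smooth_has_derivative]])
        (use gx assms v in auto)
    then show ?thesis
    proof (rule has_derivative_eq_rhs)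
      show "(\<lambda>h. (frechet_derivative v (at x) h * g x ^ j
          - v x * (of_nat j * frechet_derivative g (at x) h * g x ^ (j - 1))) / (g x ^ j * g x ^ j)) =
        (\<lambda>h. (frechet_derivative v (at x) h * g x - of_nat j * v x * frechet_derivative g (at x) h)
            / g x ^ Suc j)"
        using gx by (cases j) (auto simp: field_simps fun_eq_iff)
    qed
  next
    case False
    have "v y = 0" if "y \<notin> K" for y
      using v that by blast
    then have "((\<lambda>x. v x / g x ^ j) has_derivative (\<lambda>_. 0)) (at x)"
      "v x = 0" "(v has_derivative (\<lambda>_. 0)) (at x)"
      using False by (auto intro!: has_derivative_zero_outside[of K])
    then show ?thesis
      by (simp flip: frechet_derivative_at[of v "\<lambda>_. 0"])
  qed
  have "smooth h" if "h \<in> X" for h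
    using that
  proof (rule smooth_coinduct)
    fix h x assume "h \<in> X"
    then show "h differentiable (at x)"
      using d by (auto simp: X_def differentiable_def)
  next
    fix h and b :: 'a assume "h \<in> X" and b: "b \<in> Basis"
    then obtain v j where h: "h = (\<lambda>x. v x / g x ^ j)" and v: "smooth v" "{x. v x \<noteq> 0} \<subseteq> K"
      by (auto simp: X_def)
    let ?v = "\<lambda>x. frechet_derivative v (at x) b * g x
      + (- of_nat j) * (v x * frechet_derivative g (at x) b)"
    have "smooth ?v"
      by (intro smooth_add smooth_mult smooth_const smooth_partial v assms b)
    moreover have "?v x = 0" if "x \<notin> K" for x
    proof -
      have "(v has_derivative (\<lambda>_. 0)) (at x)" "v x = 0"
        using that v by (auto intro!: has_derivative_zero_outside[of K])
      then show ?thesis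
        by (simp flip: frechet_derivative_at[of v "\<lambda>_. 0"])
    qed
    moreover have "(\<lambda>x. frechet_derivative h (at x) b) = (\<lambda>x. ?v x / g x ^ Suc j)"
      unfolding h frechet_derivative_at[OF d[OF v], symmetric] by (simp add: algebra_simps)
    ultimately show "(\<lambda>x. frechet_derivative h (at x) b) \<in> X"
      unfolding X_def mem_Collect_eq by (intro exI[of _ ?v] exI[of _ "Suc j"]) blast
  qed
  moreover have "(\<lambda>x. u x / g x) \<in> X"
    unfolding X_def mem_Collect_eq
    by (rule exI[of _ u], rule exI[of _ 1]) (use assms closure_subset[of "{x. u x \<noteq> 0}"] in \<open>auto simp: K_def\<close>)
  ultimately show ?thesis
    by blast
qed

subsection \<open>Fourier transforms of test functions decay\<close>

lemma test_function_eq_0: "x \<notin> closure {x. \<phi> x \<noteq> 0} \<Longrightarrow> \<phi> x = 0"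
  using closure_subset[of "{x. \<phi> x \<noteq> 0}"] by blast

lemma test_function_intro:
  assumes "test_function_on U \<phi>" "smooth \<psi>" "\<And>x. x \<notin> closure {x. \<phi> x \<noteq> 0} \<Longrightarrow> \<psi> x = 0"
  shows "test_function_on U \<psi>"
proof -
  have "{x. \<psi> x \<noteq> 0} \<subseteq> closure {x. \<phi> x \<noteq> 0}"
    using assms(3) by blast
  then have sub: "closure {x. \<psi> x \<noteq> 0} \<subseteq> closure {x. \<phi> x \<noteq> 0}"
    by (simp add: closure_minimal)
  moreover have "compact (closure {x. \<psi> x \<noteq> 0})"
    using assms(1) sub unfolding test_function_on_def
    by (metis closed_closure bounded_subset compact_eq_bounded_closed)
  ultimately show ?thesis
    using assms unfolding test_function_on_def by blast
qed

lemma test_function_partial: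
  assumes "test_function_on U \<phi>" "b \<in> Basis"
  shows "test_function_on U (\<lambda>x. frechet_derivative \<phi> (at x) b)"
proof (rule test_function_intro[OF assms(1)])
  show "smooth (\<lambda>x. frechet_derivative \<phi> (at x) b)"
    using assms by (auto simp: test_function_on_def intro: smooth_partial)
  fix x assume "x \<notin> closure {x. \<phi> x \<noteq> 0}"
  then have "(\<phi> has_derivative (\<lambda>_. 0)) (at x)"
    by (intro has_derivative_zero_outside[of "closure {x. \<phi> x \<noteq> 0}"] test_function_eq_0) auto
  then show "frechet_derivative \<phi> (at x) b = 0"
    by (simp flip: frechet_derivative_at)
qed

lemma test_function_bound:
  assumes "test_function_on U \<phi>"
  obtains M where "M \<ge> 0" "\<And>x. norm (\<phi> x) \<le> M"
proof -
  let ?K = "closure {x. \<phi> x \<noteq> 0}"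
  have "compact (\<phi> ` ?K)"
    using assms by (intro compact_continuous_image smooth_continuous_on) (auto simp: test_function_on_def)
  then obtain M where M: "\<And>x. x \<in> ?K \<Longrightarrow> norm (\<phi> x) \<le> M"
    by (meson bounded_iff compact_imp_bounded image_eqI)
  have "norm (\<phi> x) \<le> max M 0" for x
  proof (cases "x \<in> ?K")
    case True
    then show ?thesis
      using M[of x] by linarith
  next
    case False
    from test_function_eq_0[OF this] show ?thesis
      by simp
  qed
  then show ?thesis
    by (intro that[of "max M 0"]) simp
qed

lemma test_function_integrable:
  assumes "test_function_on U \<phi>"
  shows "integrable lborel \<phi>"
proof -
  let ?K = "closure {x. \<phi> x \<noteq> 0}"
  have "integrable lborel (\<lambda>x. indicator ?K x *\<^sub>R \<phi> x)"
    using assms by (intro borel_integrable_compact smooth_continuous_on) (auto simp: test_function_on_def)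
  moreover have "(\<lambda>x. indicator ?K x *\<^sub>R \<phi> x) = \<phi>"
  proof
    fix x
    show "indicator ?K x *\<^sub>R \<phi> x = \<phi> x"
    proof (cases "x \<in> ?K")
      case False
      from test_function_eq_0[OF this] show ?thesis
        by simp
    qed simp
  qed
  ultimately show ?thesis
    by simp
qed

lemma smooth_has_derivative_line:
  assumes "smooth f"
  shows "((\<lambda>t. f (x + t *\<^sub>R b)) has_derivative
    (\<lambda>s. s *\<^sub>R frechet_derivative f (at (x + t *\<^sub>R b)) b)) (at t)"
proof -
  have "((\<lambda>t. x + t *\<^sub>R b) has_derivative (\<lambda>s. s *\<^sub>R b)) (at t)"
    by (auto intro!: derivative_eq_intros)
  from has_derivative_compose[OF this smooth_has_derivative[OF assms]] show ?thesis
    by (rule has_derivative_eq_rhs)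
      (auto simp: fun_eq_iff linear_cmul[OF linear_frechet_derivative[OF smooth_differentiable[OF assms]]])
qed

lemma has_vector_derivative_quotient:
  assumes "(f has_vector_derivative D) (at 0)"
  shows "((\<lambda>t. (f t - f 0) /\<^sub>R t) \<longlongrightarrow> D) (at 0)"
proof -
  have "((\<lambda>t. norm (f t - f 0 - t *\<^sub>R D) / norm t) \<longlongrightarrow> 0) (at 0)"
    using assms by (simp add: has_vector_derivative_def has_derivative_at)
  moreover have "norm (f t - f 0 - t *\<^sub>R D) / norm t = norm ((f t - f 0) /\<^sub>R t - D)" if "t \<noteq> 0" for t
  proof -
    have "(f t - f 0) /\<^sub>R t - D = (f t - f 0 - t *\<^sub>R D) /\<^sub>R t"
      using that by (simp add: scaleR_diff_right)
    then show ?thesis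
      by (simp add: divide_inverse mult.commute)
  qed
  ultimately have "((\<lambda>t. norm ((f t - f 0) /\<^sub>R t - D)) \<longlongrightarrow> 0) (at 0)"
    by (rule Lim_transform_eventually[OF _ eventually_mono[OF eventually_neq_at_within[of 0]]]) auto
  then show ?thesis
    using tendsto_norm_zero_iff LIM_zero_iff by blast
qed

text \<open>The difference quotients of \<open>\<phi>\<close> have integral \<open>0\<close> by translation invariance.\<close>

lemma integral_partial_eq_0:
  assumes test: "test_function_on U \<phi>" and b: "b \<in> Basis"
  shows "(LINT x|lborel. frechet_derivative \<phi> (at x) b) = 0"
proof -
  let ?K = "closure {x. \<phi> x \<noteq> 0}"
  let ?D = "\<lambda>x. frechet_derivative \<phi> (at x) b"
  have sm: "smooth \<phi>" and "compact ?K"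
    using test by (auto simp: test_function_on_def)
  then obtain R where R: "\<And>x. x \<in> ?K \<Longrightarrow> norm x \<le> R"
    by (meson bounded_iff compact_imp_bounded)
  obtain M where M: "M \<ge> 0" "\<And>x. norm (?D x) \<le> M"
    using test_function_bound[OF test_function_partial[OF test b]] by blast
  define h where "h i = 1 / real (Suc i)" for i
  have h: "h i > 0" "h i \<le> 1" for i
    by (auto simp: h_def)
  have h0: "h \<longlonglongrightarrow> 0"
    unfolding h_def using LIMSEQ_inverse_real_of_nat by (simp add: inverse_eq_divide)
  define q where "q i x = (\<phi> (x + h i *\<^sub>R b) - \<phi> x) /\<^sub>R h i" for i x
  have [measurable]: "\<phi> \<in> borel_measurable borel"
    using sm by (intro borel_measurable_continuous_onI smooth_continuous_on)
  have int: "integrable lborel \<phi>"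
    using test by (rule test_function_integrable)
  have shift: "integrable lborel (\<lambda>x. \<phi> (x + c))" "(LINT x|lborel. \<phi> (x + c)) = (LINT x|lborel. \<phi> x)" for c
  proof -
    have "integrable (distr lborel borel ((+) c)) \<phi>"
      using int by (simp add: lborel_distr_plus)
    then show "integrable lborel (\<lambda>x. \<phi> (x + c))"
      by (subst (asm) integrable_distr_eq) (auto simp: add.commute)
    have "(LINT x|lborel. \<phi> x) = (LINT x|distr lborel borel ((+) c). \<phi> x)"
      by (simp add: lborel_distr_plus)
    then show "(LINT x|lborel. \<phi> (x + c)) = (LINT x|lborel. \<phi> x)"
      by (subst (asm) integral_distr) (auto simp: add.commute)
  qed
  \<comment> \<open>Dominated convergence with the mean value bound \<open>M\<close> on the ball of
    radius \<open>R + 1\<close>: the steps have length at most 1, so both values in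
    \<open>q i x\<close> vanish outside this ball.\<close>
  have "(\<lambda>i. LINT x|lborel. q i x) \<longlonglongrightarrow> (LINT x|lborel. ?D x)"
  proof (rule integral_dominated_convergence[where w = "\<lambda>x. M * indicator (cball 0 (R + 1)) x"])
    show "integrable lborel (\<lambda>x. M * indicator (cball 0 (R + 1)) x)"
      by (intro integrable_mult_right integrable_real_indicator emeasure_lborel_cball_finite) auto
    show "AE x in lborel. (\<lambda>i. q i x) \<longlonglongrightarrow> ?D x"
    proof (rule AE_I2)
      fix x
      have "((\<lambda>t. \<phi> (x + t *\<^sub>R b)) has_vector_derivative ?D x) (at 0)"
        using smooth_has_derivative_line[OF sm, of x b 0] by (simp add: has_vector_derivative_def)
      then have "((\<lambda>t. (\<phi> (x + t *\<^sub>R b) - \<phi> (x + 0 *\<^sub>R b)) /\<^sub>R t) \<longlongrightarrow> ?D x) (at 0)"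
        by (rule has_vector_derivative_quotient)
      moreover have "filterlim h (at 0) sequentially"
        using h0 h by (auto simp: filterlim_at intro!: always_eventually) (metis less_irrefl)
      ultimately show "(\<lambda>i. q i x) \<longlonglongrightarrow> ?D x"
        unfolding q_def using filterlim_compose by fastforce
    qed
    show "AE x in lborel. norm (q i x) \<le> M * indicator (cball 0 (R + 1)) x" for i
    proof (rule AE_I2)
      fix x
      show "norm (q i x) \<le> M * indicator (cball 0 (R + 1)) x"
      proof (cases "norm x \<le> R + 1")
        case True
        have "norm (\<phi> (x + h i *\<^sub>R b) - \<phi> (x + 0 *\<^sub>R b)) \<le> M * norm (h i - 0)"
        proof (rule differentiable_bound[of UNIV])
          fix t :: real
          show "((\<lambda>t. \<phi> (x + t *\<^sub>R b)) has_derivative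
            (\<lambda>s. s *\<^sub>R frechet_derivative \<phi> (at (x + t *\<^sub>R b)) b)) (at t within UNIV)"
            using smooth_has_derivative_line[OF sm] by auto
          show "onorm (\<lambda>s. s *\<^sub>R frechet_derivative \<phi> (at (x + t *\<^sub>R b)) b) \<le> M"
            using M by (intro onorm_bound) (auto simp: mult.commute[of M] intro!: mult_left_mono)
        qed auto
        moreover have "norm (q i x) = norm (\<phi> (x + h i *\<^sub>R b) - \<phi> x) / h i"
          using h[of i] by (simp add: q_def divide_inverse mult.commute)
        ultimately show ?thesis
          using True h[of i] by (simp add: pos_divide_le_eq)
      next
        case False
        have "norm x - 1 \<le> norm (x + h i *\<^sub>R b)"
          using norm_triangle_ineq4[of "x + h i *\<^sub>R b" "h i *\<^sub>R b"] h[of i] b by simp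
        then have "x \<notin> ?K" "x + h i *\<^sub>R b \<notin> ?K"
          using R[of x] R[of "x + h i *\<^sub>R b"] False by (auto intro: ccontr)
        then show ?thesis
          using M(1) by (simp add: q_def test_function_eq_0[OF \<open>x \<notin> ?K\<close>]
              test_function_eq_0[OF \<open>x + h i *\<^sub>R b \<notin> ?K\<close>])
      qed
    qed
    show "?D \<in> borel_measurable lborel"
      using sm b by (simp add: borel_measurable_continuous_onI smooth_continuous_on smooth_partial)
    show "q i \<in> borel_measurable lborel" for i
      unfolding q_def by measurable
  qed
  moreover have "(LINT x|lborel. q i x) = 0" for i
    unfolding q_def using shift int by simp
  ultimately show ?thesis
    by (simp add: LIMSEQ_const_iff)
qed

lemma smooth_character:
  "smooth (\<lambda>x::'a::euclidean_space. exp (- (2 * of_real pi * \<i> * of_real (\<xi> \<bullet> x))))"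
proof -
  have "(\<lambda>z. exp (- (2 * of_real pi * \<i> * z))) holomorphic_on UNIV"
    by (intro holomorphic_intros)
  from smooth_entire[OF this, of \<xi>] show ?thesis
    by (simp add: inner_commute)
qed

lemma has_derivative_character:
  "((\<lambda>x. exp (- (2 * of_real pi * \<i> * of_real (\<xi> \<bullet> x)))) has_derivative
    (\<lambda>y. - (2 * of_real pi * \<i> * of_real (\<xi> \<bullet> y)) * exp (- (2 * of_real pi * \<i> * of_real (\<xi> \<bullet> x)))))
    (at x)"
proof -
  have "((\<lambda>x. - (2 * of_real pi * \<i> * of_real (\<xi> \<bullet> x)) :: complex) has_derivative
      (\<lambda>y. - (2 * of_real pi * \<i> * of_real (\<xi> \<bullet> y)))) (at x)"
    by (auto intro!: derivative_eq_intros)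
  from has_derivative_compose[OF this DERIV_exp[unfolded has_field_derivative_def]] show ?thesis
    by (simp add: mult.commute)
qed

lemma norm_character [simp]: "norm (exp (- (2 * of_real pi * \<i> * of_real t))) = 1"
  using norm_exp_i_times[of "- (2 * pi * t)"] by (simp add: mult_ac)

lemma test_function_character:
  assumes "test_function_on U \<phi>"
  shows "test_function_on U (\<lambda>x. \<phi> x * exp (- (2 * of_real pi * \<i> * of_real (\<xi> \<bullet> x))))"
proof (rule test_function_intro[OF assms])
  show "smooth (\<lambda>x. \<phi> x * exp (- (2 * of_real pi * \<i> * of_real (\<xi> \<bullet> x))))"
    using assms by (intro smooth_mult smooth_character) (auto simp: test_function_on_def)
  show "\<phi> x * exp (- (2 * of_real pi * \<i> * of_real (\<xi> \<bullet> x))) = 0"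
    if "x \<notin> closure {x. \<phi> x \<noteq> 0}" for x
    using test_function_eq_0[OF that] by simp
qed

text \<open>Integration by parts without boundary terms: \<open>\<phi>\<close> times the character
  is itself a test function, so its derivative has integral 0, and the product rule splits that
  integral into the two sides.\<close>

lemma fourier_partial:
  assumes test: "test_function_on U \<phi>" and b: "b \<in> Basis"
  shows "fourier (\<lambda>x. frechet_derivative \<phi> (at x) b) \<xi>
    = 2 * of_real pi * \<i> * of_real (\<xi> \<bullet> b) * fourier \<phi> \<xi>"
proof -
  let ?e = "\<lambda>x. exp (- (2 * of_real pi * \<i> * of_real (\<xi> \<bullet> x)))"
  have sm: "smooth \<phi>"
    using test by (auto simp: test_function_on_def)
  have "frechet_derivative (\<lambda>x. \<phi> x * ?e x) (at x) b =
      frechet_derivative \<phi> (at x) b * ?e x - 2 * of_real pi * \<i> * of_real (\<xi> \<bullet> b) * (\<phi> x * ?e x)" for x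
    by (subst frechet_derivative_at[OF has_derivative_mult[OF smooth_has_derivative[OF sm]
          has_derivative_character], symmetric]) (simp add: algebra_simps)
  moreover have "(LINT x|lborel. frechet_derivative (\<lambda>x. \<phi> x * ?e x) (at x) b) = 0"
    by (rule integral_partial_eq_0[OF test_function_character[OF test] b])
  moreover have "integrable lborel (\<lambda>x. frechet_derivative \<phi> (at x) b * ?e x)"
    "integrable lborel (\<lambda>x. \<phi> x * ?e x)"
    using test b by (auto intro!: test_function_integrable test_function_character test_function_partial)
  ultimately show ?thesis
    by (simp add: fourier_def)
qed

text \<open>\<open>\<theta>\<close> is \<open>\<psi>\<close> minus its second partial derivative
  along \<open>b\<close>. Unlike a plain derivative, this operator multiplies the transform by a
  factor that is at least 1, so it can be divided out everywhere.\<close>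

lemma test_function_one_minus_partial2:
  assumes "test_function_on U \<psi>" "b \<in> Basis"
  obtains \<theta> where "test_function_on U \<theta>"
    "\<And>\<xi>. fourier \<theta> \<xi> = (1 + (2 * of_real pi * of_real (\<xi> \<bullet> b))\<^sup>2) * fourier \<psi> \<xi>"
proof -
  define D where "D = (\<lambda>x. frechet_derivative \<psi> (at x) b)"
  define D2 where "D2 = (\<lambda>x. frechet_derivative D (at x) b)"
  have D: "test_function_on U D" "\<And>\<xi>. fourier D \<xi> = 2 * of_real pi * \<i> * of_real (\<xi> \<bullet> b) * fourier \<psi> \<xi>"
    unfolding D_def using assms test_function_partial fourier_partial by blast+
  have D2: "test_function_on U D2"
    "\<And>\<xi>. fourier D2 \<xi> = 2 * of_real pi * \<i> * of_real (\<xi> \<bullet> b) * (2 * of_real pi * \<i> * of_real (\<xi> \<bullet> b) * fourier \<psi> \<xi>)"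
    unfolding D2_def using D assms test_function_partial[OF D(1)] fourier_partial[OF D(1)] by simp_all
  show ?thesis
  proof (rule that[of "\<lambda>x. \<psi> x + (-1) * D2 x"])
    let ?K = "closure {x. \<psi> x \<noteq> 0}"
    have D_0: "D y = 0" if "y \<notin> ?K" for y
    proof -
      have "(\<psi> has_derivative (\<lambda>_. 0)) (at y)"
        using that by (intro has_derivative_zero_outside[of ?K] test_function_eq_0) auto
      then show ?thesis
        unfolding D_def by (simp flip: frechet_derivative_at)
    qed
    have "D2 x = 0" if "x \<notin> ?K" for x
      unfolding D2_def
      using frechet_derivative_at[OF has_derivative_zero_outside[OF _ D_0 that], symmetric]
      by simp
    then have "\<psi> x + (-1) * D2 x = 0" if "x \<notin> ?K" for x
      using that test_function_eq_0[OF that] by simp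
    moreover have "smooth (\<lambda>x. \<psi> x + (-1) * D2 x)"
      using assms(1) D2(1) unfolding test_function_on_def
      by (intro smooth_add smooth_mult smooth_const) blast+
    ultimately show "test_function_on U (\<lambda>x. \<psi> x + (-1) * D2 x)"
      by (intro test_function_intro[OF assms(1)])
    fix \<xi>
    have "fourier (\<lambda>x. \<psi> x + (-1) * D2 x) \<xi> = fourier \<psi> \<xi> - fourier D2 \<xi>"
      unfolding fourier_def
      using test_function_integrable[OF test_function_character[OF assms(1)]]
        test_function_integrable[OF test_function_character[OF D2(1)]]
      by (subst Bochner_Integration.integral_diff[symmetric]) (auto simp: algebra_simps)
    then show "fourier (\<lambda>x. \<psi> x + (-1) * D2 x) \<xi>
        = (1 + (2 * of_real pi * of_real (\<xi> \<bullet> b))\<^sup>2) * fourier \<psi> \<xi>"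
      by (simp add: D2 algebra_simps power2_eq_square)
  qed
qed

text \<open>This weight takes the place of the Schwartz seminorms. Its product form reduces
  integrability to one dimension, and over bounded distances it changes by a bounded factor
  only.\<close>

definition decay :: "'a::euclidean_space \<Rightarrow> real" where
  "decay x = (\<Prod>b\<in>Basis. 1 / (1 + (x \<bullet> b)\<^sup>2))"

lemma one_plus_square_pos [simp]: "1 + (t::real)\<^sup>2 > 0"
  by (simp add: add_pos_nonneg)

lemma decay_pos [simp]: "decay x > 0"
  unfolding decay_def by (intro prod_pos) auto

text \<open>Applying one minus the second partial derivative once for every basis vector yields a
  test function \<open>\<theta>\<close> whose transform is bounded by the integral of its norm;
  dividing by the accumulated factor leaves the weight.\<close>

lemma fourier_decay:
  fixes \<psi> :: "'a::euclidean_space \<Rightarrow> complex"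
  assumes "test_function_on U \<psi>"
  obtains K where "K \<ge> 0" "\<And>\<xi>. norm (fourier \<psi> \<xi>) \<le> K * decay \<xi>"
proof -
  have "\<exists>\<theta>. test_function_on U \<theta> \<and>
      (\<forall>\<xi>. fourier \<theta> \<xi> = (\<Prod>b\<in>B. 1 + (2 * of_real pi * of_real (\<xi> \<bullet> b))\<^sup>2) * fourier \<psi> \<xi>)"
    if "finite B" "B \<subseteq> Basis" for B :: "'a set"
    using that
  proof (induction B)
    case empty
    then show ?case
      using assms by auto
  next
    case (insert b B)
    then obtain \<theta> where \<theta>: "test_function_on U \<theta>"
      "\<And>\<xi>. fourier \<theta> \<xi> = (\<Prod>b\<in>B. 1 + (2 * of_real pi * of_real (\<xi> \<bullet> b))\<^sup>2) * fourier \<psi> \<xi>"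
      by auto
    obtain \<theta>' where "test_function_on U \<theta>'"
      "\<And>\<xi>. fourier \<theta>' \<xi> = (1 + (2 * of_real pi * of_real (\<xi> \<bullet> b))\<^sup>2) * fourier \<theta> \<xi>"
      using test_function_one_minus_partial2[OF \<theta>(1), of b] insert by auto
    then show ?case
      using insert \<theta>(2) by (intro exI[of _ \<theta>']) (auto simp: mult_ac)
  qed
  from this[of Basis] obtain \<theta> where \<theta>: "test_function_on U \<theta>"
      "\<And>\<xi>. fourier \<theta> \<xi> = (\<Prod>b\<in>Basis. 1 + (2 * of_real pi * of_real (\<xi> \<bullet> b))\<^sup>2) * fourier \<psi> \<xi>"
    by auto
  have "norm (fourier \<psi> \<xi>) \<le> (LINT x|lborel. norm (\<theta> x)) * decay \<xi>" for \<xi>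
  proof -
    have "norm (fourier \<theta> \<xi>) \<le> (LINT x|lborel. norm (\<theta> x * exp (- (2 * of_real pi * \<i> * of_real (\<xi> \<bullet> x)))))"
      unfolding fourier_def by (rule integral_norm_bound)
    then have 1: "norm (fourier \<theta> \<xi>) \<le> (LINT x|lborel. norm (\<theta> x))"
      by (simp add: norm_mult)
    have "(\<Prod>b\<in>Basis. 1 + (\<xi> \<bullet> b)\<^sup>2) \<le> (\<Prod>b\<in>Basis. norm (1 + (2 * of_real pi * of_real (\<xi> \<bullet> b))\<^sup>2 :: complex))"
    proof (intro prod_mono conjI)
      fix b :: 'a assume "b \<in> Basis"
      have "1 \<le> (2 * pi)\<^sup>2"
        using pi_gt3 by (intro one_le_power) auto
      then have "1 + (\<xi> \<bullet> b)\<^sup>2 \<le> 1 + (2 * pi * (\<xi> \<bullet> b))\<^sup>2"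
        using mult_right_mono[of 1 "(2 * pi)\<^sup>2" "(\<xi> \<bullet> b)\<^sup>2"] by (simp add: power_mult_distrib)
      also have "\<dots> = norm (of_real (1 + (2 * pi * (\<xi> \<bullet> b))\<^sup>2) :: complex)"
        by (subst norm_of_real) (simp add: abs_of_nonneg)
      finally show "1 + (\<xi> \<bullet> b)\<^sup>2 \<le> norm (1 + (2 * of_real pi * of_real (\<xi> \<bullet> b))\<^sup>2 :: complex)"
        by simp
    qed auto
    also have "\<dots> = norm (\<Prod>b\<in>Basis. 1 + (2 * of_real pi * of_real (\<xi> \<bullet> b))\<^sup>2 :: complex)"
      by (simp add: prod_norm)
    finally have "(\<Prod>b\<in>Basis. 1 + (\<xi> \<bullet> b)\<^sup>2) * norm (fourier \<psi> \<xi>) \<le> norm (fourier \<theta> \<xi>)"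
      unfolding \<theta>(2) norm_mult by (rule mult_right_mono) auto
    also note 1
    finally show ?thesis
      by (simp add: decay_def prod_dividef prod_pos field_simps)
  qed
  then show ?thesis
    by (intro that[of "LINT x|lborel. norm (\<theta> x)"]) auto
qed

text \<open>A Peetre inequality in each coordinate, \<open>1 + s\<^sup>2 \<le> 2 * (1 + (s -
  t)\<^sup>2) * (1 + t\<^sup>2)\<close>, multiplied over the basis; hence the exponent
  \<open>DIM('a)\<close>.\<close>

lemma decay_le_add:
  fixes x y :: "'a::euclidean_space"
  assumes "norm (x - y) \<le> R"
  shows "decay y \<le> (2 * (1 + R\<^sup>2)) ^ DIM('a) * decay x"
proof -
  have "decay y \<le> (\<Prod>b\<in>(Basis::'a set). (2 * (1 + R\<^sup>2)) * (1 / (1 + (x \<bullet> b)\<^sup>2)))"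
    unfolding decay_def
  proof (intro prod_mono conjI)
    fix b :: 'a assume b: "b \<in> Basis"
    define s t where "s = x \<bullet> b" and "t = y \<bullet> b"
    have "\<bar>s - t\<bar> \<le> R"
      using Basis_le_norm[OF b, of "x - y"] assms by (simp add: s_def t_def inner_diff_left)
    then have "(s - t)\<^sup>2 \<le> R\<^sup>2"
      using abs_le_square_iff[of "s - t" R] by auto
    have "1 + s\<^sup>2 \<le> 2 * (1 + (s - t)\<^sup>2) * (1 + t\<^sup>2)"
    proof -
      have "s\<^sup>2 \<le> 2 * (s - t)\<^sup>2 + 2 * t\<^sup>2"
        \<comment> \<open>The square of \<open>s - 2 * t\<close> is exactly the difference of the
          two sides.\<close>
        using zero_le_power2[of "s - 2 * t"] by (simp add: power2_eq_square algebra_simps)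
      moreover have "0 \<le> t\<^sup>2 * (s - t)\<^sup>2"
        by simp
      moreover have "2 * (1 + (s - t)\<^sup>2) * (1 + t\<^sup>2) = 2 + 2 * (s - t)\<^sup>2 + 2 * t\<^sup>2 + 2 * (t\<^sup>2 * (s - t)\<^sup>2)"
        by algebra
      ultimately show ?thesis
        by linarith
    qed
    also have "\<dots> \<le> 2 * (1 + R\<^sup>2) * (1 + t\<^sup>2)"
      using \<open>(s - t)\<^sup>2 \<le> R\<^sup>2\<close> by (intro mult_right_mono) auto
    finally have "(1 + s\<^sup>2) / ((1 + s\<^sup>2) * (1 + t\<^sup>2)) \<le> 2 * (1 + R\<^sup>2) * (1 + t\<^sup>2) / ((1 + s\<^sup>2) * (1 + t\<^sup>2))"
      by (intro divide_right_mono) auto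
    then show "1 / (1 + (y \<bullet> b)\<^sup>2) \<le> 2 * (1 + R\<^sup>2) * (1 / (1 + (x \<bullet> b)\<^sup>2))"
      using one_plus_square_pos[of s] one_plus_square_pos[of t]
      by (simp add: s_def[symmetric] t_def[symmetric] less_imp_neq[symmetric])
  qed auto
  also have "\<dots> = (2 * (1 + R\<^sup>2)) ^ DIM('a) * decay x"
    unfolding decay_def prod.distrib prod_constant power_mult_distrib by (rule refl)
  finally show ?thesis .
qed

lemma borel_measurable_decay [measurable]: "decay \<in> borel_measurable borel"
  unfolding decay_def by measurable

lemma nn_integral_decay_finite:
  "(\<integral>\<^sup>+x. ennreal (decay (x::'a::euclidean_space)) \<partial>lborel) < \<infinity>"
proof -
  have "integrable lborel (\<lambda>x::real. inverse (1 + x\<^sup>2))"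
    using integrable_inverse_1_plus_square by (simp add: set_integrable_def)
  then have fin: "(\<integral>\<^sup>+x. ennreal (1 / (1 + x\<^sup>2)) \<partial>(lborel::real measure)) < \<infinity>"
    by (simp add: real_integrable_def inverse_eq_divide less_top)
  have "(\<integral>\<^sup>+x. ennreal (decay (x::'a)) \<partial>lborel) =
      (\<integral>\<^sup>+x. (\<Prod>b\<in>Basis. ennreal (1 / (1 + (x \<bullet> b)\<^sup>2))) \<partial>(lborel::'a measure))"
    unfolding decay_def by (subst prod_ennreal) auto
  also have "\<dots> = (\<Prod>b\<in>(Basis::'a set). (\<integral>\<^sup>+x. ennreal (1 / (1 + x\<^sup>2)) \<partial>(lborel::real measure)))"
    by (rule nn_integral_lborel_prod) auto
  also have "\<dots> < \<infinity>"
    using fin by (simp add: power_less_top_ennreal)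
  finally show ?thesis .
qed

subsection \<open>Density of a multiple tiling\<close>

text \<open>A basic open set that meets \<open>S\<close> in one point determines that point, which
  injects \<open>S\<close> into a countable base. Discreteness alone does not give local finiteness,
  so the first null set argument has to rest on countability.\<close>

lemma countable_discrete:
  fixes S :: "'a::second_countable_topology set"
  assumes "discrete S"
  shows "countable S"
proof -
  obtain B :: "'a set set" where B: "countable B" "topological_basis B"
    using ex_countable_basis by blast
  have "\<exists>C\<in>B. C \<inter> S = {x}" if x: "x \<in> S" for x
  proof -
    obtain T where T: "open T" "T \<inter> S = {x}"
      using assms x unfolding discrete_def isolated_in_def by metis
    then obtain C where "C \<in> B" "x \<in> C" "C \<subseteq> T"
      using topological_basisE[OF B(2) T(1), of x] by auto
    then show ?thesis
      using T by blast
  qed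
  then obtain C where C: "\<And>x. x \<in> S \<Longrightarrow> C x \<in> B \<and> C x \<inter> S = {x}"
    by metis
  then have "inj_on C S"
    by (intro inj_onI) (metis singleton_inject)
  moreover have "C ` S \<subseteq> B"
    using C by blast
  ultimately show ?thesis
    by (meson B(1) countable_image_inj_on countable_subset)
qed

lemma indicator_translate: "indicator ((+) l ` P) x = indicator P (x - (l::'a::ab_group_add))"
  by (auto simp: indicator_def image_iff) (metis diff_add_cancel add.commute)

lemma emeasure_translate:
  fixes P :: "'a::euclidean_space set"
  assumes "P \<in> sets borel"
  shows "(+) l ` P \<in> sets borel" "emeasure lborel ((+) l ` P) = emeasure lborel P"
proof -
  have eq: "(+) l ` P = (\<lambda>x. x - l) -` P"
    by (auto simp: image_iff) (metis add.commute diff_add_cancel)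
  show "(+) l ` P \<in> sets borel"
    unfolding eq using assms by (intro measurable_sets_borel[of _ borel]) auto
  have "emeasure lborel P = emeasure (distr lborel borel ((+) (-l))) P"
    by (simp add: lborel_distr_plus)
  also have "\<dots> = emeasure lborel ((+) l ` P)"
    using assms by (subst emeasure_distr) (auto simp: eq intro!: arg_cong[where f = "emeasure lborel"])
  finally show "emeasure lborel ((+) l ` P) = emeasure lborel P" ..
qed

text \<open>Countably many translates of a null tile cover almost no point, whereas almost every
  point is covered \<open>k > 0\<close> times.\<close>

lemma multi_tiles_emeasure_pos:
  assumes "multi_tiles P k m" "k > 0" "countable {l. m l > 0}" "P \<in> sets borel"
  shows "emeasure lborel P > 0"
proof (rule ccontr)
  assume "\<not> emeasure lborel P > 0"
  then have "(+) l ` P \<in> null_sets lborel" for l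
    using emeasure_translate[OF assms(4), of l] by (simp add: null_sets_def emeasure_translate(2)[OF assms(4)])
  then have "AE x in lborel. \<forall>l\<in>{l. m l > 0}. x \<notin> (+) l ` P"
    using assms(3) by (intro AE_ball_countable' AE_not_in) auto
  then have "AE x in lborel. (\<Sum>\<^sub>\<infinity>l. of_nat (m l) * indicator ((+) l ` P) x) = (0 :: ennreal)"
  proof eventually_elim
    case (elim x)
    then show ?case
      by (intro infsum_0) (auto simp: indicator_def)
  qed
  with assms(1) have "AE x in (lborel::'a measure). False"
    unfolding multi_tiles_def
  proof eventually_elim
    case (elim x)
    then have "(of_nat k :: ennreal) = 0"
      by metis
    with assms(2) show ?case
      by simp
  qed
  then show False
    using ae_filter_eq_bot_iff[of "lborel::'a measure"] by (auto simp: trivial_limit_def)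
qed

lemma multi_tiles_sum_le:
  assumes "multi_tiles P k m"
  shows "AE x in lborel. \<forall>S. finite S \<longrightarrow> (\<Sum>l\<in>S. of_nat (m l) * indicator P (x - l)) \<le> (of_nat k::ennreal)"
  using assms unfolding multi_tiles_def
proof eventually_elim
  case (elim x)
  show ?case
  proof (intro allI impI)
    fix S :: "'a set" assume "finite S"
    then have "(\<Sum>l\<in>S. of_nat (m l) * indicator ((+) l ` P) x) \<le> (\<Sum>\<^sub>\<infinity>l. of_nat (m l) * indicator ((+) l ` P) x :: ennreal)"
      by (subst nonneg_infsum_complete) (auto intro!: SUP_upper)
    then show "(\<Sum>l\<in>S. of_nat (m l) * indicator P (x - l)) \<le> (of_nat k::ennreal)"
      using elim by (simp add: indicator_translate)
  qed
qed

text \<open>A density bound, obtained by integrating over \<open>x\<close> the sum of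
  \<open>m l * decay l\<close> over the tiles that contain \<open>x\<close>. Integration gives each
  term the volume \<open>V\<close> of the tile. Pointwise, \<open>decay l \<le> C * decay x\<close>
  because \<open>x - l\<close> is bounded, and the multiplicities add up to at most
  \<open>k\<close>. Finite partial sums are thus at most \<open>C * k * A / V\<close>.\<close>

lemma multi_tiles_summable_decay:
  fixes P :: "'a::euclidean_space set"
  assumes tiles: "multi_tiles P k m" and pos: "emeasure lborel P > 0" and cpt: "compact P"
  shows "(\<lambda>l. of_nat (m l) * decay l) summable_on UNIV"
proof -
  have [measurable]: "P \<in> sets borel"
    using cpt by (rule borel_compact)
  obtain R where R: "\<And>y. y \<in> P \<Longrightarrow> norm y \<le> R"
    using cpt by (meson bounded_iff compact_imp_bounded)
  define C where "C = (2 * (1 + R\<^sup>2)) ^ DIM('a)"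
  have C: "C \<ge> 0"
    by (simp add: C_def)
  define V where "V = measure lborel P"
  have fin: "emeasure lborel P < \<infinity>"
    using cpt emeasure_compact_finite by blast
  then have V: "emeasure lborel P = ennreal V" "V > 0"
    using pos emeasure_eq_ennreal_measure[of lborel P] by (auto simp: V_def less_top zero_less_measure_iff)
  obtain A where A: "(\<integral>\<^sup>+x. ennreal (decay (x::'a)) \<partial>lborel) = ennreal A" "A \<ge> 0"
    using nn_integral_decay_finite[where 'a = 'a] by (metis ennreal_cases infinity_ennreal_def less_irrefl)
  have bound: "(\<Sum>l\<in>S. of_nat (m l) * decay l) \<le> C * k * A / V" if S: "finite S" for S
  proof -
    have "ennreal ((\<Sum>l\<in>S. of_nat (m l) * decay l) * V) = (\<Sum>l\<in>S. ennreal (m l * decay l) * emeasure lborel P)"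
      using V(2) by (subst V) (simp add: sum_distrib_right less_imp_le ennreal_mult''[symmetric] sum_ennreal)
    also have "\<dots> = (\<Sum>l\<in>S. \<integral>\<^sup>+x. ennreal (m l * decay l) * indicator P (x - l) \<partial>lborel)"
      by (intro sum.cong refl, subst nn_integral_cmult)
        (auto simp: emeasure_translate nn_integral_indicator simp flip: indicator_translate
          intro!: borel_measurable_indicator)
    also have "\<dots> = (\<integral>\<^sup>+x. (\<Sum>l\<in>S. ennreal (m l * decay l) * indicator P (x - l)) \<partial>lborel)"
      by (subst nn_integral_sum) auto
    also have "\<dots> \<le> (\<integral>\<^sup>+x. ennreal (C * k) * ennreal (decay (x::'a)) \<partial>lborel)"
    proof (rule nn_integral_mono_AE)
      show "AE x in lborel. (\<Sum>l\<in>S. ennreal (m l * decay l) * indicator P (x - l)) \<le>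
          ennreal (C * k) * ennreal (decay x)"
        using multi_tiles_sum_le[OF tiles]
      proof eventually_elim
        case (elim x)
        have "(\<Sum>l\<in>S. ennreal (m l * decay l) * indicator P (x - l)) \<le>
            (\<Sum>l\<in>S. ennreal (C * decay x) * (of_nat (m l) * indicator P (x - l)))"
        proof (rule sum_mono)
          fix l
          have "ennreal (m l * decay l) \<le> ennreal (C * decay x) * of_nat (m l)" if "x - l \<in> P"
          proof -
            have "decay l \<le> C * decay x"
              unfolding C_def by (rule decay_le_add) (rule R[OF that])
            then have "m l * decay l \<le> C * decay x * m l"
              using mult_right_mono[of "decay l" "C * decay x" "m l"] by (simp add: mult.commute)
            then have "ennreal (m l * decay l) \<le> ennreal (C * decay x * m l)"
              by (rule ennreal_leI)
            also have "\<dots> = ennreal (C * decay x) * of_nat (m l)"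
              using C by (simp add: ennreal_mult' ennreal_of_nat_eq_real_of_nat less_imp_le)
            finally show ?thesis .
          qed
          then show "ennreal (m l * decay l) * indicator P (x - l) \<le>
              ennreal (C * decay x) * (of_nat (m l) * indicator P (x - l))"
            by (auto simp: indicator_def)
        qed
        also have "\<dots> \<le> ennreal (C * decay x) * of_nat k"
          unfolding sum_distrib_left[symmetric] using elim S by (intro mult_left_mono) auto
        also have "\<dots> = ennreal (C * k) * ennreal (decay x)"
          using C by (simp add: ennreal_mult ennreal_of_nat_eq_real_of_nat less_imp_le mult_ac)
        finally show ?case .
      qed
    qed
    also have "\<dots> = ennreal (C * k * A)"
      using A C by (subst nn_integral_cmult) (auto simp: ennreal_mult'')
    finally have "(\<Sum>l\<in>S. of_nat (m l) * decay l) * V \<le> C * k * A"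
      using A C by (subst (asm) ennreal_le_iff) auto
    then show ?thesis
      using V by (simp add: field_simps)
  qed
  show ?thesis
    by (rule nonneg_bdd_above_summable_on)
      (use bound in \<open>auto simp: less_imp_le intro!: bdd_aboveI2\<close>)
qed

text \<open>Points within distance \<open>R\<close> of \<open>x\<close> have weight at least
  \<open>c > 0\<close>, so infinitely many of them would make the sum diverge.\<close>

lemma summable_decay_locally_finite:
  fixes m :: "'a::euclidean_space \<Rightarrow> nat"
  assumes "(\<lambda>l. of_nat (m l) * decay l) summable_on UNIV"
  shows "finite {l. m l > 0 \<and> norm (x - l) \<le> R}"
proof -
  let ?S = "{l. m l > 0 \<and> norm (x - l) \<le> R}"
  define c where "c = decay x / (2 * (1 + R\<^sup>2)) ^ DIM('a)"
  have c: "c > 0"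
    unfolding c_def by (intro divide_pos_pos zero_less_power mult_pos_pos) auto
  have "(\<lambda>l. of_nat (m l) * decay l) summable_on ?S"
    by (rule summable_on_subset_banach[OF assms]) auto
  then have "(\<lambda>_. c) summable_on ?S"
  proof (rule summable_on_comparison_test)
    fix l assume "l \<in> ?S"
    then have le: "decay x \<le> (2 * (1 + R\<^sup>2)) ^ DIM('a) * decay l" and "real (m l) \<ge> 1"
      by (simp_all only: mem_Collect_eq norm_minus_commute[of x] decay_le_add) auto
    have "c \<le> decay l"
      using le unfolding c_def by (subst pos_divide_le_eq) (auto simp: mult.commute add_pos_nonneg)
    moreover from \<open>real (m l) \<ge> 1\<close> have "1 * decay l \<le> m l * decay l"
      by (intro mult_right_mono) (auto simp: less_imp_le)
    ultimately show "c \<le> of_nat (m l) * decay l"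
      by linarith
  qed (use c in auto)
  then show ?thesis
  proof (rule contrapos_pp)
    assume "infinite ?S"
    then show "\<not> (\<lambda>_. c) summable_on ?S"
      using c by (intro infsum_diverge_constant) auto
  qed
qed

section \<open>Tile counts at every point off the bounding hyperplanes\<close>

lemma AE_lborel_open_ex:
  fixes S :: "'a::euclidean_space set"
  assumes "AE x in lborel. Q x" "open S" "S \<noteq> {}"
  shows "\<exists>x\<in>S. Q x"
proof (rule ccontr)
  assume none: "\<not> (\<exists>x\<in>S. Q x)"
  from assms(1) have "AE x in lborel. x \<notin> S"
    by eventually_elim (use none in blast)
  then have null: "S \<in> null_sets lborel"
    using assms(2) by (subst (asm) AE_iff_null_sets[symmetric]) auto
  obtain c r where r: "r > 0" "ball c r \<subseteq> S"
    using assms(2,3) open_contains_ball by blast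
  then have "ball c r \<in> null_sets lborel"
    by (intro null_sets_subset[OF null]) auto
  then have "measure lborel (ball c r) = 0"
    by (simp add: measure_eq_0_null_sets)
  then show False
    using content_ball_pos[OF r(1), of c] by simp
qed

lemma eventually_nhds_halfspace:
  fixes w y l :: "'a::real_inner"
  assumes "w \<bullet> (y - l) \<noteq> c"
  shows "\<forall>\<^sub>F y' in nhds y. (w \<bullet> (y' - l) \<le> c) = (w \<bullet> (y - l) \<le> c)"
proof -
  have lim: "((\<lambda>y'. w \<bullet> (y' - l)) \<longlongrightarrow> w \<bullet> (y - l)) (nhds y)"
    by (intro tendsto_intros filterlim_ident)
  show ?thesis
  proof (cases "w \<bullet> (y - l) < c")
    case True
    from order_tendstoD(2)[OF lim this] show ?thesis
      by eventually_elim (use True in auto)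
  next
    case False
    then have "w \<bullet> (y - l) > c"
      using assms by simp
    from order_tendstoD(1)[OF lim this] show ?thesis
      by eventually_elim (use False assms in auto)
  qed
qed

text \<open>Off the bounding hyperplanes of the finitely many nearby translates, membership in each
  of them is locally constant, so the count at \<open>y\<close> equals that at some nearby
  \<open>y'\<close> where the almost everywhere identity holds. A tile that contains
  \<open>y'\<close> with \<open>dist y' y < 1\<close> has its base point within \<open>R + 1\<close>
  of \<open>y\<close>.\<close>

lemma multi_tiles_count:
  fixes P :: "'a::euclidean_space set"
  assumes tiles: "multi_tiles P k m"
    and fin: "finite {l. m l > 0 \<and> norm (y - l) \<le> R + 1}"
    and bound: "P \<subseteq> cball 0 R"
    and H: "finite H" "P = {z. \<forall>(w, c)\<in>H. w \<bullet> z \<le> c}"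
    and regular: "\<And>l w c. m l > 0 \<Longrightarrow> norm (y - l) \<le> R + 1 \<Longrightarrow> (w, c) \<in> H \<Longrightarrow> w \<bullet> (y - l) \<noteq> c"
  shows "(\<Sum>l | m l > 0 \<and> norm (y - l) \<le> R + 1. real (m l) * indicator P (y - l)) = k"
proof -
  have R: "norm z \<le> R" if "z \<in> P" for z
    using bound that by auto
  let ?L = "{l. m l > 0 \<and> norm (y - l) \<le> R + 1}"
  have "\<forall>\<^sub>F y' in nhds y. \<forall>l\<in>?L. \<forall>h\<in>H. (fst h \<bullet> (y' - l) \<le> snd h) = (fst h \<bullet> (y - l) \<le> snd h)"
    using regular
    by (intro eventually_ball_finite fin H ballI eventually_nhds_halfspace) auto
  moreover have "\<forall>\<^sub>F y' in nhds y. dist y' y < 1"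
    by (rule eventually_nhds_metric[THEN iffD2]) (auto intro: exI[of _ 1])
  ultimately have "\<forall>\<^sub>F y' in nhds y. dist y' y < 1 \<and> (\<forall>l\<in>?L. y' - l \<in> P \<longleftrightarrow> y - l \<in> P)"
    by eventually_elim (auto simp: H(2) case_prod_unfold)
  then obtain S where S: "open S" "y \<in> S"
    "\<And>y'. y' \<in> S \<Longrightarrow> dist y' y < 1 \<and> (\<forall>l\<in>?L. y' - l \<in> P \<longleftrightarrow> y - l \<in> P)"
    unfolding eventually_nhds by blast
  obtain y' where y': "y' \<in> S" "(\<Sum>\<^sub>\<infinity>l. of_nat (m l) * indicator ((+) l ` P) y') = (of_nat k :: ennreal)"
    using AE_lborel_open_ex[OF tiles[unfolded multi_tiles_def] S(1)] S(2) by blast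
  have "(of_nat k :: ennreal) = (\<Sum>\<^sub>\<infinity>l\<in>?L. of_nat (m l) * indicator P (y - l))"
    unfolding y'(2)[symmetric]
  proof (rule infsum_cong_neutral)
    fix l assume "l \<in> UNIV - ?L"
    moreover have "norm (y - l) \<le> R + 1" if "y' - l \<in> P"
      using R[OF that] S(3)[OF y'(1)] norm_triangle_ineq[of "y - y'" "y' - l"]
      by (simp add: dist_norm norm_minus_commute)
    ultimately show "of_nat (m l) * indicator ((+) l ` P) y' = (0 :: ennreal)"
      unfolding indicator_translate by (auto simp: indicator_def)
  next
    fix l assume "l \<in> UNIV \<inter> ?L"
    then show "of_nat (m l) * indicator ((+) l ` P) y' = (of_nat (m l) * indicator P (y - l) :: ennreal)"
      using S(3)[OF y'(1)] unfolding indicator_translate by (auto simp: indicator_def)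
  qed auto
  also have "\<dots> = (\<Sum>l\<in>?L. of_nat (m l) * indicator P (y - l))"
    using fin by simp
  also have "\<dots> = (\<Sum>l\<in>?L. ennreal (real (m l) * indicator P (y - l)))"
    by (intro sum.cong) (auto simp: indicator_def ennreal_of_nat_eq_real_of_nat)
  also have "\<dots> = ennreal (\<Sum>l\<in>?L. real (m l) * indicator P (y - l))"
    by (rule sum_ennreal) auto
  finally have "ennreal (real k) = ennreal (\<Sum>l\<in>?L. real (m l) * indicator P (y - l))"
    by (simp add: ennreal_of_nat_eq_real_of_nat)
  then show ?thesis
    by (subst (asm) ennreal_inj) (auto intro!: sum_nonneg)
qed

subsection \<open>Polyhedra near a generic point\<close>

lemma orthogonal_expansion3:
  fixes e v n :: "'a::euclidean_space"
  assumes dim: "DIM('a) = 3" and nz: "e \<noteq> 0" "v \<noteq> 0" "n \<noteq> 0"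
    and orth: "e \<bullet> v = 0" "e \<bullet> n = 0" "v \<bullet> n = 0"
  shows "x \<bullet> y = (x \<bullet> e) * (y \<bullet> e) / (e \<bullet> e) + (x \<bullet> v) * (y \<bullet> v) / (v \<bullet> v) + (x \<bullet> n) * (y \<bullet> n) / (n \<bullet> n)"
proof -
  have ne: "e \<noteq> v" "e \<noteq> n" "v \<noteq> n"
    using nz orth by auto
  have "independent {e, v, n}"
    using nz orth by (intro pairwise_orthogonal_independent)
      (auto simp: pairwise_def orthogonal_def inner_commute)
  then have "UNIV \<subseteq> span {e, v, n}"
    using ne dim by (intro card_ge_dim_independent) (auto simp: dim_UNIV)
  moreover define u where "u = x - (x \<bullet> e / (e \<bullet> e)) *\<^sub>R e - (x \<bullet> v / (v \<bullet> v)) *\<^sub>R v - (x \<bullet> n / (n \<bullet> n)) *\<^sub>R n"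
  moreover have "orthogonal u b" if "b \<in> {e, v, n}" for b
    using that nz orth by (auto simp: u_def orthogonal_def inner_diff_left inner_diff_right inner_commute)
  ultimately have "orthogonal u u"
    by (meson UNIV_I orthogonal_to_span subsetD)
  then have "u = 0"
    by (simp add: orthogonal_def)
  then have x: "x = (x \<bullet> e / (e \<bullet> e)) *\<^sub>R e + (x \<bullet> v / (v \<bullet> v)) *\<^sub>R v + (x \<bullet> n / (n \<bullet> n)) *\<^sub>R n"
    by (simp add: u_def algebra_simps)
  show ?thesis
    by (subst (1) x) (simp add: inner_add_left inner_add_right inner_commute)
qed

lemma orth_to_two_parallel:
  fixes e v n :: "'a::euclidean_space"
  assumes dim: "DIM('a) = 3" and nz: "e \<noteq> 0" "v \<noteq> 0" "n \<noteq> 0"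
    and orth: "e \<bullet> v = 0" "e \<bullet> n = 0" "v \<bullet> n = 0"
    and x: "x \<bullet> v = 0" "x \<bullet> n = 0"
  shows "x = (x \<bullet> e / (e \<bullet> e)) *\<^sub>R e"
proof -
  define r where "r = x - (x \<bullet> e / (e \<bullet> e)) *\<^sub>R e"
  have "x \<bullet> r = (x \<bullet> e / (e \<bullet> e)) * (e \<bullet> r)"
    using orthogonal_expansion3[OF dim nz orth, of x r] x by (simp add: inner_commute)
  then have "r \<bullet> r = 0"
    by (subst r_def) (simp add: inner_diff_left)
  then show ?thesis
    by (simp add: r_def)
qed

section \<open>Shifts at two infinitesimal scales\<close>

lemma eventually_sgn_at_right:
  fixes s t :: real
  shows "\<forall>\<^sub>F b in at_right 0. sgn (s + b * t) = (if s \<noteq> 0 then sgn s else sgn t)"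
proof (cases "s = 0")
  case True
  have "\<forall>\<^sub>F b in at_right (0::real). b > 0"
    by (rule eventually_at_right_less)
  then show ?thesis
    by eventually_elim (simp add: True sgn_mult)
next
  case False
  have lim: "((\<lambda>b. s + b * t) \<longlongrightarrow> s) (at_right 0)"
    by (auto intro!: tendsto_eq_intros)
  show ?thesis
  proof (cases "s > 0")
    case True
    from order_tendstoD(1)[OF lim this] show ?thesis
      by eventually_elim (use True in auto)
  next
    case False
    with \<open>s \<noteq> 0\<close> have "s < 0"
      by simp
    from order_tendstoD(2)[OF lim this] show ?thesis
      by eventually_elim (use \<open>s < 0\<close> in auto)
  qed
qed

text \<open>A lexicographic sign rule: the inner limit in \<open>b\<close> is taken for fixed
  \<open>a\<close>, so \<open>b * u\<close> matters only if both \<open>s\<close> and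
  \<open>t\<close> vanish.\<close>

lemma eventually_sgn_at_right2:
  fixes s t u :: real
  shows "\<forall>\<^sub>F a in at_right 0. \<forall>\<^sub>F b in at_right 0.
    sgn (s + a * t + b * u) = (if s \<noteq> 0 then sgn s else if t \<noteq> 0 then sgn t else sgn u)"
  using eventually_sgn_at_right[of s t]
proof eventually_elim
  case (elim a)
  from eventually_sgn_at_right[of "s + a * t" u] show ?case
    by eventually_elim (use elim in \<open>auto split: if_splits simp: sgn_zero_iff\<close>)
qed

text \<open>\<open>enters H z v n\<close> means that \<open>z + a *\<^sub>R v + b *\<^sub>R n\<close> lies in the polyhedron \<open>H\<close> for infinitesimal
  \<open>0 < b \<lless> a \<lless> 1\<close>, provided that \<open>z\<close> is \<open>nondegenerate\<close>.\<close>

definition enters :: "('a::real_inner \<times> real) set \<Rightarrow> 'a \<Rightarrow> 'a \<Rightarrow> 'a \<Rightarrow> bool" where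
  "enters H z v n \<longleftrightarrow> (\<forall>(w, c)\<in>H.
    w \<bullet> z < c \<or> w \<bullet> z = c \<and> (w \<bullet> v < 0 \<or> w \<bullet> v = 0 \<and> w \<bullet> n < 0))"

text \<open>This excludes bounding planes through \<open>z\<close> that contain both shift
  directions, the one case in which all three terms of the lexicographic sign vanish.\<close>

definition nondegenerate :: "('a::real_inner \<times> real) set \<Rightarrow> 'a \<Rightarrow> 'a \<Rightarrow> 'a \<Rightarrow> bool" where
  "nondegenerate H z v n \<longleftrightarrow> (\<forall>(w, c)\<in>H. w \<bullet> z = c \<longrightarrow> w \<bullet> v = 0 \<longrightarrow> w \<bullet> n \<noteq> 0)"

lemma eventually_enters:
  fixes z v n :: "'a::real_inner"
  assumes "finite H" "nondegenerate H z v n"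
  shows "\<forall>\<^sub>F a in at_right 0. \<forall>\<^sub>F b in at_right 0.
    (\<forall>(w, c)\<in>H. w \<bullet> (z + a *\<^sub>R v + b *\<^sub>R n) \<noteq> c) \<and>
    ((\<forall>(w, c)\<in>H. w \<bullet> (z + a *\<^sub>R v + b *\<^sub>R n) \<le> c) \<longleftrightarrow> enters H z v n)"
proof -
  have "\<forall>\<^sub>F a in at_right 0. \<forall>\<^sub>F b in at_right 0. \<forall>h\<in>H.
      sgn (fst h \<bullet> z - snd h + a * (fst h \<bullet> v) + b * (fst h \<bullet> n)) =
      (if fst h \<bullet> z - snd h \<noteq> 0 then sgn (fst h \<bullet> z - snd h)
       else if fst h \<bullet> v \<noteq> 0 then sgn (fst h \<bullet> v) else sgn (fst h \<bullet> n))"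
    unfolding eventually_ball_finite_distrib[OF assms(1)] using eventually_sgn_at_right2 by blast
  then show ?thesis
  proof (rule eventually_mono, elim eventually_mono)
    fix a b
    assume sgn: "\<forall>h\<in>H.
      sgn (fst h \<bullet> z - snd h + a * (fst h \<bullet> v) + b * (fst h \<bullet> n)) =
      (if fst h \<bullet> z - snd h \<noteq> 0 then sgn (fst h \<bullet> z - snd h)
       else if fst h \<bullet> v \<noteq> 0 then sgn (fst h \<bullet> v) else sgn (fst h \<bullet> n))"
    have *: "w \<bullet> (z + a *\<^sub>R v + b *\<^sub>R n) \<noteq> c \<and> (w \<bullet> (z + a *\<^sub>R v + b *\<^sub>R n) \<le> c \<longleftrightarrow>
        w \<bullet> z < c \<or> w \<bullet> z = c \<and> (w \<bullet> v < 0 \<or> w \<bullet> v = 0 \<and> w \<bullet> n < 0))"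
      if h: "(w, c) \<in> H" for w c
    proof -
      define r where "r = w \<bullet> z - c + a * (w \<bullet> v) + b * (w \<bullet> n)"
      have r: "w \<bullet> (z + a *\<^sub>R v + b *\<^sub>R n) = c + r"
        by (simp add: r_def inner_add_right)
      have "sgn r = (if w \<bullet> z - c \<noteq> 0 then sgn (w \<bullet> z - c)
          else if w \<bullet> v \<noteq> 0 then sgn (w \<bullet> v) else sgn (w \<bullet> n))"
        using sgn h unfolding r_def by fastforce
      moreover have "w \<bullet> z = c \<Longrightarrow> w \<bullet> v = 0 \<Longrightarrow> w \<bullet> n \<noteq> 0"
        using assms(2) h unfolding nondegenerate_def by blast
      ultimately show ?thesis
        unfolding r by (auto simp: sgn_if split: if_splits)
    qed
    show "(\<forall>(w, c)\<in>H. w \<bullet> (z + a *\<^sub>R v + b *\<^sub>R n) \<noteq> c) \<and>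
        ((\<forall>(w, c)\<in>H. w \<bullet> (z + a *\<^sub>R v + b *\<^sub>R n) \<le> c) \<longleftrightarrow> enters H z v n)"
      unfolding enters_def using * by (fastforce simp: split_beta)
  qed
qed

lemma eventually_at_right_nested_ex:
  assumes "\<forall>\<^sub>F a in at_right (0::real). \<forall>\<^sub>F b in at_right (0::real). Q a b"
  obtains a b where "a > 0" "b > 0" "Q a b"
proof -
  have "\<forall>\<^sub>F a in at_right (0::real). a > 0 \<and> (\<forall>\<^sub>F b in at_right (0::real). Q a b)"
    using assms eventually_at_right_less by (rule eventually_conj[rotated])
  then obtain a where a: "a > 0" "\<forall>\<^sub>F b in at_right (0::real). Q a b"
    using eventually_happens'[OF trivial_limit_at_right_real] by blast
  have "\<forall>\<^sub>F b in at_right (0::real). b > 0 \<and> Q a b"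
    using a(2) eventually_at_right_less by (rule eventually_conj[rotated])
  then show ?thesis
    using eventually_happens'[OF trivial_limit_at_right_real] a(1) that by blast
qed

text \<open>In the facet plane the level sets of \<open>v\<close> are the lines parallel to
  \<open>e\<close>, and \<open>P\<close> meets the line of an edge only in that edge. If
  \<open>G\<close> had a point \<open>y\<close> on the other side of this line from
  \<open>y'\<close>, the segment from \<open>y\<close> to \<open>y'\<close> would cross the edge,
  and the face property would put \<open>y\<close> itself on it.\<close>

lemma edge_extreme_in_facet:
  fixes e v n :: "'a::euclidean_space"
  assumes dim: "DIM('a) = 3" and nz: "e \<noteq> 0" "v \<noteq> 0" "n \<noteq> 0"
    and orth: "e \<bullet> v = 0" "e \<bullet> n = 0" "v \<bullet> n = 0"
    and "convex P" and E: "closed_segment q (q + e) face_of P"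
    and G: "G = P \<inter> {x. n \<bullet> x = d}" "closed_segment q (q + e) \<subseteq> G"
    and y': "y' \<in> G" "v \<bullet> y' > v \<bullet> q" and y: "y \<in> G"
  shows "v \<bullet> q \<le> v \<bullet> y" "v \<bullet> y = v \<bullet> q \<longleftrightarrow> y \<in> closed_segment q (q + e)"
proof -
  let ?E = "closed_segment q (q + e)"
  have E_iff: "x \<in> ?E" if x: "x \<in> G" "v \<bullet> x = v \<bullet> q" for x
  proof -
    have "q \<in> G"
      using G(2) by auto
    then have "n \<bullet> (x - q) = 0" "v \<bullet> (x - q) = 0"
      using x G(1) by (auto simp: inner_diff_right)
    then have "x - q = ((x - q) \<bullet> e / (e \<bullet> e)) *\<^sub>R e"
      using orth_to_two_parallel[OF dim nz orth, of "x - q"] by (simp add: inner_commute)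
    then have "x = q + ((x - q) \<bullet> e / (e \<bullet> e)) *\<^sub>R (q + e - q)"
      by (simp add: algebra_simps)
    then have "x \<in> affine hull {q, q + e}"
      unfolding affine_hull_2_alt by blast
    then have "x \<in> affine hull ?E"
      by (simp add: segment_convex_hull)
    then show "x \<in> ?E"
      using face_of_imp_eq_affine_Int[OF \<open>convex P\<close> E] x G(1) by blast
  qed
  have v_E: "v \<bullet> x = v \<bullet> q" if "x \<in> ?E" for x
    using that orth by (auto simp: in_segment inner_add_right algebra_simps inner_commute)
  show "v \<bullet> q \<le> v \<bullet> y"
  proof (rule ccontr)
    assume "\<not> v \<bullet> q \<le> v \<bullet> y"
    then have lt: "v \<bullet> y < v \<bullet> q"
      by simp
    define s where "s = (v \<bullet> q - v \<bullet> y) / (v \<bullet> y' - v \<bullet> y)"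
    have s: "0 < s" "s < 1"
      using lt y' by (auto simp: s_def divide_simps)
    define x where "x = (1 - s) *\<^sub>R y + s *\<^sub>R y'"
    have "v \<bullet> x = v \<bullet> y + s * (v \<bullet> y' - v \<bullet> y)"
      by (simp add: x_def inner_add_right algebra_simps)
    also have "\<dots> = v \<bullet> q"
      using lt y' by (simp add: s_def)
    finally have "v \<bullet> x = v \<bullet> q" .
    moreover have "x \<in> G"
    proof -
      have "x \<in> P"
        using \<open>convex P\<close> y y' s G(1) unfolding x_def convex_alt by auto
      moreover have "n \<bullet> x = d"
        using y y' G(1) by (simp add: x_def inner_add_right algebra_simps)
      ultimately show ?thesis
        using G(1) by blast
    qed
    ultimately have "x \<in> ?E"
      using E_iff by blast
    moreover have "x \<in> open_segment y y'"
      using s lt y' by (auto simp: in_segment x_def)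
    ultimately have "y \<in> ?E"
      using face_ofD[OF E, of x y y'] y y' G(1) by blast
    then show False
      using v_E[of y] lt by simp
  qed
  show "v \<bullet> y = v \<bullet> q \<longleftrightarrow> y \<in> ?E"
    using E_iff y v_E by blast
qed

section \<open>Infinitesimal shifts of a generic point relative to a facet\<close>

lemma not_enters_outside: "z \<notin> {x. \<forall>(w, c)\<in>H. w \<bullet> x \<le> c} \<Longrightarrow> \<not> enters H z v n"
  unfolding enters_def by fastforce

text \<open>Every facet hyperplane through a generic point is parallel to \<open>e\<close>.\<close>

definition generic :: "('a::real_inner \<times> real) set \<Rightarrow> 'a \<Rightarrow> 'a \<Rightarrow> bool" where
  "generic H e z \<longleftrightarrow> (\<forall>(w, c)\<in>H. w \<bullet> e \<noteq> 0 \<longrightarrow> w \<bullet> z \<noteq> c)"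

context
  fixes e v n z :: "'a::euclidean_space" and H :: "('a \<times> real) set" and P :: "'a set"
  assumes dim: "DIM('a) = 3" and nz: "e \<noteq> 0" "v \<noteq> 0" "n \<noteq> 0"
    and orth: "e \<bullet> v = 0" "e \<bullet> n = 0" "v \<bullet> n = 0"
    and H: "finite H" "\<forall>(w, c)\<in>H. w \<noteq> 0" and P: "P = {x. \<forall>(w, c)\<in>H. w \<bullet> x \<le> c}"
    and generic: "generic H e z"
begin

lemma inner_self_pos: "v \<bullet> v > 0" "n \<bullet> n > 0"
  using nz by simp_all

text \<open>A bounding hyperplane through a generic point has its normal \<open>w\<close> orthogonal
  to \<open>e\<close>, so the first term of the orthogonal expansion drops out.\<close>

lemma active_normal_expansion:
  assumes "(w, c) \<in> H" "w \<bullet> z = c"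
  shows "w \<bullet> x = (w \<bullet> v) * (x \<bullet> v) / (v \<bullet> v) + (w \<bullet> n) * (x \<bullet> n) / (n \<bullet> n)"
  using orthogonal_expansion3[OF dim nz orth, of w x] generic assms by (auto simp: generic_def)

lemma generic_nondegenerate: "nondegenerate H z v n"
  unfolding nondegenerate_def
proof clarify
  fix w c assume w: "(w, w \<bullet> z) \<in> H" "w \<bullet> v = 0" "w \<bullet> n = 0"
  then have "w \<bullet> w = 0"
    using active_normal_expansion[OF w(1) refl, of w] by simp
  with H(2) w(1) show False
    by auto
qed

lemma enters_ex:
  assumes "enters H z v n"
  obtains a b where "a > 0" "b > 0" "z + a *\<^sub>R v + b *\<^sub>R n \<in> P"
proof (rule eventually_at_right_nested_ex[OF eventually_enters[OF H(1) generic_nondegenerate]])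
  fix a b :: real
  assume "a > 0" "b > 0" "(\<forall>(w, c)\<in>H. w \<bullet> (z + a *\<^sub>R v + b *\<^sub>R n) \<noteq> c) \<and>
    (\<forall>(w, c)\<in>H. w \<bullet> (z + a *\<^sub>R v + b *\<^sub>R n) \<le> c) = enters H z v n"
  then show ?thesis
    using assms that unfolding P by blast
qed

lemma not_enters_above_facet:
  assumes "P \<subseteq> {x. n \<bullet> x \<le> d}" "n \<bullet> z = d"
  shows "\<not> enters H z v n"
proof
  assume "enters H z v n"
  then obtain a b where ab: "a > 0" "b > 0" "z + a *\<^sub>R v + b *\<^sub>R n \<in> P"
    by (rule enters_ex)
  then have "n \<bullet> (z + a *\<^sub>R v + b *\<^sub>R n) \<le> d"
    using assms(1) by blast
  moreover have "n \<bullet> (z + a *\<^sub>R v + b *\<^sub>R n) = d + b * (n \<bullet> n)"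
    using orth assms(2) by (simp add: inner_add_right inner_commute)
  moreover have "b * (n \<bullet> n) > 0"
    using ab nz(3) by simp
  ultimately show False
    by linarith
qed

lemma stays_along:
  assumes "z \<in> P" and active: "\<And>w c. (w, c) \<in> H \<Longrightarrow> w \<bullet> z = c \<Longrightarrow> w \<bullet> v \<le> 0"
  obtains a where "a > 0" "z + a *\<^sub>R v \<in> P"
proof -
  have "\<forall>\<^sub>F a in at_right (0::real). \<forall>h\<in>H. sgn (fst h \<bullet> z - snd h + a * (fst h \<bullet> v)) =
      (if fst h \<bullet> z - snd h \<noteq> 0 then sgn (fst h \<bullet> z - snd h) else sgn (fst h \<bullet> v))"
    unfolding eventually_ball_finite_distrib[OF H(1)] using eventually_sgn_at_right by blast
  then have "\<forall>\<^sub>F a in at_right (0::real). a > 0 \<and> z + a *\<^sub>R v \<in> P"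
    using eventually_at_right_less
  proof eventually_elim
    case (elim a)
    have "w \<bullet> (z + a *\<^sub>R v) \<le> c" if h: "(w, c) \<in> H" for w c
    proof -
      define r where "r = w \<bullet> z - c + a * (w \<bullet> v)"
      have "sgn r = (if w \<bullet> z - c \<noteq> 0 then sgn (w \<bullet> z - c) else sgn (w \<bullet> v))"
        using elim(1) h unfolding r_def by fastforce
      moreover have "w \<bullet> z \<le> c"
        using assms(1) h unfolding P by blast
      ultimately have "r \<le> 0"
        using active[OF h] by (auto simp: sgn_if split: if_splits)
      then show ?thesis
        by (simp add: r_def inner_add_right)
    qed
    then show ?case
      using elim(2) unfolding P by blast
  qed
  then show ?thesis
    using eventually_happens'[OF trivial_limit_at_right_real] that by blast
qed

text \<open>The shift along \<open>- n\<close> goes away from the facet into \<open>P\<close>, so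
  the \<open>v\<close> shift decides, and it leaves \<open>G\<close> precisely on the edge
  \<open>E\<close> where \<open>v\<close> is maximal.\<close>

lemma enters_below_facet_iff:
  assumes below: "P \<subseteq> {x. n \<bullet> x \<le> d}" "y0 \<in> P" "n \<bullet> y0 < d"
    and G: "G = P \<inter> {x. n \<bullet> x = d}" "z \<in> G"
    and M: "\<And>y. y \<in> G \<Longrightarrow> v \<bullet> y \<le> M" "\<And>y. y \<in> G \<Longrightarrow> v \<bullet> y = M \<longleftrightarrow> y \<in> E" "y1 \<in> E" "y1 \<in> G"
  shows "enters H z v (- n) \<longleftrightarrow> z \<notin> E"
proof
  assume ent: "enters H z v (- n)"
  have "w \<bullet> v \<le> 0" if "(w, c) \<in> H" "w \<bullet> z = c" for w c
    using ent that unfolding enters_def by fastforce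
  then obtain a where a: "a > 0" "z + a *\<^sub>R v \<in> P"
    using stays_along G by blast
  then have "z + a *\<^sub>R v \<in> G"
    using G orth by (simp add: inner_add_right inner_commute)
  then have "v \<bullet> (z + a *\<^sub>R v) \<le> M"
    by (rule M)
  moreover have "a * (v \<bullet> v) > 0"
    using a nz by simp
  ultimately have "v \<bullet> z < M"
    by (simp add: inner_add_right)
  then show "z \<notin> E"
    using M(2)[OF G(2)] by auto
next
  assume z: "z \<notin> E"
  have "w \<bullet> z = c \<and> (w \<bullet> v < 0 \<or> w \<bullet> v = 0 \<and> w \<bullet> (- n) < 0)"
    if h: "(w, c) \<in> H" and nless: "\<not> w \<bullet> z < c" for w c
  proof -
    have wP: "w \<bullet> y \<le> c" if "y \<in> P" for y
      using h that unfolding P by blast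
    then have wz: "w \<bullet> z = c"
      using nless G by force
    note w = active_normal_expansion[OF h wz]
    have "\<not> w \<bullet> v > 0"
    proof
      assume pos: "w \<bullet> v > 0"
      \<comment> \<open>The vector \<open>y1 - z\<close> lies in the facet plane, so only its
        \<open>v\<close> component pairs with \<open>w\<close>; going from \<open>z\<close> towards
        the edge would therefore violate the constraint of \<open>w\<close>.\<close>
      have "w \<bullet> (y1 - z) = (w \<bullet> v) * ((y1 - z) \<bullet> v) / (v \<bullet> v)"
        using w[of "y1 - z"] M(4) G by (simp add: inner_diff_left inner_diff_right inner_commute)
      moreover have "w \<bullet> (y1 - z) \<le> 0"
        using wP[of y1] M(4) G wz by (simp add: inner_diff_right)
      ultimately have "(y1 - z) \<bullet> v \<le> 0"
        using pos inner_self_pos(1) by (simp add: divide_le_0_iff mult_le_0_iff)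
      then have "M \<le> v \<bullet> z"
        using M(2)[OF M(4)] M(3) by (simp add: inner_diff_left inner_diff_right inner_commute)
      then show False
        using M(1,2)[OF G(2)] z by auto
    qed
    \<comment> \<open>If \<open>w\<close> is orthogonal to \<open>v\<close> as well, it is a
      multiple of \<open>n\<close>, and the point \<open>y0\<close> strictly below the facet forces
      the multiple to be positive.\<close>
    moreover have "w \<bullet> n > 0" if v0: "w \<bullet> v = 0"
    proof (rule ccontr)
      assume "\<not> w \<bullet> n > 0"
      moreover have "w \<bullet> n \<noteq> 0"
        using generic_nondegenerate h wz v0 unfolding nondegenerate_def by blast
      ultimately have neg: "w \<bullet> n < 0"
        by simp
      have "w \<bullet> (y0 - z) = (w \<bullet> n) * ((y0 - z) \<bullet> n) / (n \<bullet> n)"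
        using w[of "y0 - z"] v0 by simp
      moreover have "w \<bullet> (y0 - z) \<le> 0"
        using wP[of y0] below wz by (simp add: inner_diff_right)
      moreover have "(y0 - z) \<bullet> n < 0"
        using below G by (simp add: inner_diff_left inner_diff_right inner_commute)
      then have "(w \<bullet> n) * ((y0 - z) \<bullet> n) / (n \<bullet> n) > 0"
        using neg nz by (simp add: zero_less_divide_iff zero_less_mult_iff)
      ultimately show False
        by simp
    qed
    ultimately show ?thesis
      using wz by (simp add: not_less) (metis order_le_less)
  qed
  then show "enters H z v (- n)"
    unfolding enters_def by blast
qed

text \<open>An active normal orthogonal to \<open>v\<close> would be a nonzero multiple of
  \<open>n\<close>, so \<open>z\<close> would be extreme in \<open>P\<close> for \<open>n\<close>,
  against \<open>y1\<close> and \<open>y2\<close>. Hence \<open>v\<close> decides every active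
  constraint and the sign of the \<open>n\<close> shift is irrelevant.\<close>

lemma enters_off_facets_iff:
  assumes "z \<in> P" "y1 \<in> P" "n \<bullet> z < n \<bullet> y1" "y2 \<in> P" "n \<bullet> y2 < n \<bullet> z"
  shows "enters H z v n \<longleftrightarrow> enters H z v (- n)"
proof -
  have "w \<bullet> v \<noteq> 0" if h: "(w, c) \<in> H" and wz: "w \<bullet> z = c" for w c
  proof
    assume v0: "w \<bullet> v = 0"
    have le: "w \<bullet> (y - z) \<le> 0" if "y \<in> P" for y
      using h that wz unfolding P by (fastforce simp: inner_diff_right)
    have "w \<bullet> n \<noteq> 0"
      using generic_nondegenerate h wz v0 unfolding nondegenerate_def by blast
    have eq: "w \<bullet> (y - z) = (w \<bullet> n) * ((y - z) \<bullet> n) / (n \<bullet> n)" for y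
      using active_normal_expansion[OF h wz, of "y - z"] v0 by simp
    have "(y1 - z) \<bullet> n > 0" "(y2 - z) \<bullet> n < 0"
      using assms by (simp_all add: inner_diff_left inner_diff_right inner_commute)
    then show False
      using le[OF assms(2)] le[OF assms(4)] \<open>w \<bullet> n \<noteq> 0\<close> inner_self_pos(2)
      by (auto simp del: inner_gt_zero_iff simp add: eq divide_le_0_iff mult_le_0_iff)
  qed
  then show ?thesis
    unfolding enters_def by fastforce
qed

end

text \<open>At a generic point of \<open>F\<close> no shift with \<open>n\<close> enters, and with
  \<open>- n\<close> the shifts along \<open>v\<close> and \<open>- v\<close> fail exactly on the
  legs at \<open>p + \<tau>\<^sub>1\<close> and at \<open>p\<close>. On the opposite facet
  \<open>n\<close> and \<open>- n\<close> exchange their roles, which reverses the signs. Elsewhere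
  in \<open>P\<close> the two \<open>n\<close> shifts agree, and outside \<open>P\<close> nothing
  enters.\<close>

lemma four_legged_second_difference:
  fixes P :: "'a::euclidean_space set"
  assumes dim: "DIM('a) = 3" and poly: "polyhedron P"
    and H: "finite H" "\<forall>(w, c)\<in>H. w \<noteq> 0" and P: "P = {x. \<forall>(w, c)\<in>H. w \<bullet> x \<le> c}"
    and full: "\<forall>n d. n \<noteq> 0 \<longrightarrow> \<not> P \<subseteq> {x. n \<bullet> x = d}"
    and frame: "four_legged_frame P e \<tau>\<^sub>1 \<tau>\<^sub>2" and \<tau>: "\<tau>\<^sub>1 \<noteq> 0"
  obtains p v n where "e \<noteq> 0" "v \<noteq> 0" "n \<noteq> 0" "e \<bullet> v = 0" "e \<bullet> n = 0" "v \<bullet> n = 0"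
    "closed_segment p (p + e) \<union> closed_segment (p + \<tau>\<^sub>1) (p + \<tau>\<^sub>1 + e)
      \<union> closed_segment (p + \<tau>\<^sub>2) (p + \<tau>\<^sub>2 + e) \<union> closed_segment (p + \<tau>\<^sub>2 + \<tau>\<^sub>1) (p + \<tau>\<^sub>2 + \<tau>\<^sub>1 + e) \<subseteq> P"
    "\<And>z. generic H e z \<Longrightarrow>
      of_bool (enters H z v n) - of_bool (enters H z v (- n))
        - of_bool (enters H z (- v) n) + of_bool (enters H z (- v) (- n)) =
      - (indicator (closed_segment p (p + e)) z
        - indicator (closed_segment (p + \<tau>\<^sub>1) (p + \<tau>\<^sub>1 + e)) z
        - indicator (closed_segment (p + \<tau>\<^sub>2) (p + \<tau>\<^sub>2 + e)) z
        + indicator (closed_segment (p + \<tau>\<^sub>2 + \<tau>\<^sub>1) (p + \<tau>\<^sub>2 + \<tau>\<^sub>1 + e)) z :: real)"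
proof -
  define E where "E q = closed_segment q (q + e)" for q
  obtain p c F where sym: "symmetric_about c P" and F: "F facet_of P"
    and edges: "E p edge_of P" "E (p + \<tau>\<^sub>1) edge_of P" "E (p + \<tau>\<^sub>2) edge_of P" "E (p + \<tau>\<^sub>2 + \<tau>\<^sub>1) edge_of P"
    and sub: "E p \<subseteq> F" "E (p + \<tau>\<^sub>1) \<subseteq> F" "E (p + \<tau>\<^sub>2) \<subseteq> opposite_face c F"
      "E (p + \<tau>\<^sub>2 + \<tau>\<^sub>1) \<subseteq> opposite_face c F"
    using frame unfolding four_legged_frame_def E_def by (auto simp: ac_simps)
  have cvx: "convex P"
    using poly by (rule polyhedron_imp_convex)
  have face: "E q face_of P" if "E q edge_of P" for q
    using that by (simp add: edge_of_def)
  have e: "e \<noteq> 0"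
    using edges(1) by (auto simp: E_def edge_of_def)
  obtain n d where n: "n \<noteq> 0" "P \<subseteq> {x. n \<bullet> x \<le> d}" "F = P \<inter> {x. n \<bullet> x = d}"
    using facet_of_polyhedron[OF poly F] by blast
  \<comment> \<open>The reflection in \<open>c\<close> turns the level \<open>d\<close> of
    \<open>n\<close> into \<open>d'\<close>, so \<open>F\<close> and its opposite face lie in the
    parallel supporting planes at these two levels.\<close>
  define d' where "d' = 2 * (n \<bullet> c) - d"
  have refl: "2 *\<^sub>R c - x \<in> P \<longleftrightarrow> x \<in> P" for x
    using sym unfolding symmetric_about_def
    by (metis (no_types, lifting) diff_diff_eq2 add_diff_cancel_left' imageE imageI)
  have n_refl: "n \<bullet> (2 *\<^sub>R c - x) = 2 * (n \<bullet> c) - n \<bullet> x" for x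
    by (simp add: inner_diff_right)
  have low: "P \<subseteq> {x. (- n) \<bullet> x \<le> - d'}"
  proof
    fix x assume "x \<in> P"
    then have "n \<bullet> (2 *\<^sub>R c - x) \<le> d"
      using refl n(2) by blast
    then show "x \<in> {x. (- n) \<bullet> x \<le> - d'}"
      unfolding n_refl d'_def by simp
  qed
  have opp: "opposite_face c F = P \<inter> {x. (- n) \<bullet> x = - d'}"
  proof (intro set_eqI iffI)
    fix x assume "x \<in> opposite_face c F"
    then show "x \<in> P \<inter> {x. (- n) \<bullet> x = - d'}"
      using refl by (auto simp: opposite_face_def n(3) n_refl d'_def)
  next
    fix x assume x: "x \<in> P \<inter> {x. (- n) \<bullet> x = - d'}"
    then have "2 *\<^sub>R c - x \<in> F"
      using refl n(3) by (auto simp: n_refl d'_def)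
    then show "x \<in> opposite_face c F"
      unfolding opposite_face_def by (rule rev_image_eqI) simp
  qed
  have end_in: "q \<in> E q" "q + e \<in> E q" for q
    by (auto simp: E_def)
  have ne: "e \<bullet> n = 0"
  proof -
    have "n \<bullet> p = d" "n \<bullet> (p + e) = d"
      using sub(1) end_in n(3) by blast+
    then show ?thesis
      by (simp add: inner_add_right inner_commute)
  qed
  have n\<tau>: "n \<bullet> \<tau>\<^sub>1 = 0"
  proof -
    have "n \<bullet> p = d" "n \<bullet> (p + \<tau>\<^sub>1) = d"
      using sub(1,2) end_in n(3) by blast+
    then show ?thesis
      by (simp add: inner_add_right)
  qed
  \<comment> \<open>The component of \<open>\<tau>\<^sub>1\<close> orthogonal to \<open>e\<close>
    points inside the facet from one leg to the other:
    \<open>v \<bullet> \<tau>\<^sub>1 = v \<bullet> v > 0\<close> puts the leg at \<open>p\<close>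
    at the minimum of \<open>v\<close> and the leg at \<open>p + \<tau>\<^sub>1\<close> at the
    maximum.\<close>
  define v where "v = \<tau>\<^sub>1 - (\<tau>\<^sub>1 \<bullet> e / (e \<bullet> e)) *\<^sub>R e"
  have ev: "e \<bullet> v = 0"
    using e by (simp add: v_def inner_diff_right inner_commute)
  have vn: "v \<bullet> n = 0"
    using ne n\<tau> by (simp add: v_def inner_diff_left inner_diff_right inner_commute)
  have v\<tau>: "v \<bullet> \<tau>\<^sub>1 = v \<bullet> v"
    using ev by (subst (3) v_def) (simp add: inner_diff_right inner_commute)
  \<comment> \<open>Otherwise the two legs in \<open>F\<close> lie on one line. As \<open>P\<close>
    meets that line only in the edge from \<open>p\<close> to \<open>p + e\<close>, both
    \<open>t\<close> and \<open>t + 1\<close> are in \<open>[0, 1]\<close>, so \<open>t = 0\<close>,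
    against \<open>\<tau>\<^sub>1 \<noteq> 0\<close>.\<close>
  have v: "v \<noteq> 0"
  proof
    assume "v = 0"
    define t where "t = \<tau>\<^sub>1 \<bullet> e / (e \<bullet> e)"
    have t: "\<tau>\<^sub>1 = t *\<^sub>R e"
      using \<open>v = 0\<close> by (simp add: v_def t_def)
    have "affine hull (E p) \<inter> P = E p"
      using face_of_imp_eq_affine_Int[OF cvx face[OF edges(1)]] by simp
    moreover have "affine hull (E p) = range (\<lambda>u. p + u *\<^sub>R e)"
      unfolding E_def segment_convex_hull by (simp add: affine_hull_2_alt)
    moreover have "p + \<tau>\<^sub>1 \<in> P" "p + \<tau>\<^sub>1 + e \<in> P"
      using sub(2) end_in n(3) by blast+
    moreover have "p + \<tau>\<^sub>1 = p + t *\<^sub>R e" "p + \<tau>\<^sub>1 + e = p + (t + 1) *\<^sub>R e"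
      by (auto simp: t algebra_simps)
    ultimately have mem: "p + t *\<^sub>R e \<in> E p" "p + (t + 1) *\<^sub>R e \<in> E p"
      by (metis IntI rangeI)+
    have in_E: "0 \<le> s \<and> s \<le> 1" if s: "p + s *\<^sub>R e \<in> E p" for s
    proof -
      obtain u where "p + s *\<^sub>R e = (1 - u) *\<^sub>R p + u *\<^sub>R (p + e)" "0 \<le> u" "u \<le> 1"
        using s by (auto simp: E_def in_segment)
      then have "s *\<^sub>R e = u *\<^sub>R e"
        by (simp add: algebra_simps)
      then show ?thesis
        using e \<open>0 \<le> u\<close> \<open>u \<le> 1\<close> by simp
    qed
    have "t = 0"
      using in_E[OF mem(1)] in_E[OF mem(2)] by simp
    then show False
      using t \<tau> by simp
  qed
  have vv: "v \<bullet> v > 0"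
    using v by simp
  show ?thesis
  proof (rule that[OF e v n(1) ev ne vn], fold E_def)
    show "E p \<union> E (p + \<tau>\<^sub>1) \<union> E (p + \<tau>\<^sub>2) \<union> E (p + \<tau>\<^sub>2 + \<tau>\<^sub>1) \<subseteq> P"
      using edges by (intro Un_least edge_of_imp_subset)
    fix z
    assume generic: "generic H e z"
    have mv: "- v \<noteq> 0" "e \<bullet> (- v) = 0" "- v \<bullet> n = 0" and mn: "- n \<noteq> 0" "e \<bullet> (- n) = 0" "v \<bullet> (- n) = 0" "- v \<bullet> (- n) = 0"
      using v n ev ne vn by auto
    \<comment> \<open>Stated for an arbitrary outer normal \<open>n'\<close>, so that one argument
      serves \<open>F\<close> with \<open>n\<close> and the opposite facet with
      \<open>- n\<close>.\<close>
    have facet: "\<not> enters H z v n' \<and> \<not> enters H z (- v) n' \<and>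
        (enters H z v (- n') \<longleftrightarrow> z \<notin> E (q + \<tau>\<^sub>1)) \<and> (enters H z (- v) (- n') \<longleftrightarrow> z \<notin> E q)"
      if n': "n' \<noteq> 0" "e \<bullet> n' = 0" "v \<bullet> n' = 0" and below: "P \<subseteq> {x. n' \<bullet> x \<le> d1}"
        and G: "G = P \<inter> {x. n' \<bullet> x = d1}" "z \<in> G"
        and q: "E q face_of P" "E (q + \<tau>\<^sub>1) face_of P" "E q \<subseteq> G" "E (q + \<tau>\<^sub>1) \<subseteq> G"
      for n' d1 G q
    proof -
      have mv': "- v \<bullet> n' = 0"
        using n' by simp
      obtain y0 where y0: "y0 \<in> P" "n' \<bullet> y0 < d1"
        using full n'(1) below by force
      have qG: "q \<in> G" "q + \<tau>\<^sub>1 \<in> G"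
        using q end_in by blast+
      have min: "v \<bullet> q \<le> v \<bullet> y" "v \<bullet> y = v \<bullet> q \<longleftrightarrow> y \<in> E q" if "y \<in> G" for y
        using edge_extreme_in_facet[OF dim e v n'(1) ev n'(2,3) cvx q(1)[unfolded E_def] G(1)
            q(3)[unfolded E_def] qG(2) _ that] vv v\<tau>
        by (simp_all add: E_def inner_add_right)
      have max: "- v \<bullet> (q + \<tau>\<^sub>1) \<le> - v \<bullet> y" "- v \<bullet> y = - v \<bullet> (q + \<tau>\<^sub>1) \<longleftrightarrow> y \<in> E (q + \<tau>\<^sub>1)" if "y \<in> G" for y
        using edge_extreme_in_facet[OF dim e mv(1) n'(1) mv(2) n'(2) mv' cvx q(2)[unfolded E_def] G(1)
            q(4)[unfolded E_def] qG(1) _ that] vv v\<tau>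
        by (simp_all add: E_def inner_add_right)
      have "enters H z v (- n') \<longleftrightarrow> z \<notin> E (q + \<tau>\<^sub>1)"
        by (rule enters_below_facet_iff[OF dim e v n'(1) ev n'(2,3) H P generic below y0 G,
              where M = "v \<bullet> (q + \<tau>\<^sub>1)" and ?y1.0 = "q + \<tau>\<^sub>1"])
          (use max qG end_in in auto)
      moreover have "enters H z (- v) (- n') \<longleftrightarrow> z \<notin> E q"
        by (rule enters_below_facet_iff[OF dim e mv(1) n'(1) mv(2) n'(2) mv' H P generic below y0 G,
              where M = "- v \<bullet> q" and ?y1.0 = q])
          (use min qG end_in in auto)
      moreover have "n' \<bullet> z = d1"
        using G by blast
      ultimately show ?thesis
        using not_enters_above_facet[OF dim e v n'(1) ev n'(2,3) H P generic below]
          not_enters_above_facet[OF dim e mv(1) n'(1) mv(2) n'(2) mv' H P generic below]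
        by blast
    qed
    have disj: "\<not> (z \<in> F \<and> z \<in> opposite_face c F)"
    proof
      assume "z \<in> F \<and> z \<in> opposite_face c F"
      then have "n \<bullet> z = d" "(- n) \<bullet> z = - d'"
        using opp n(3) by blast+
      then have "d = d'"
        by simp
      then have "P \<subseteq> {x. n \<bullet> x = d}"
        using n(2) low by force
      then show False
        using full n(1) by blast
    qed
    show "of_bool (enters H z v n) - of_bool (enters H z v (- n))
        - of_bool (enters H z (- v) n) + of_bool (enters H z (- v) (- n)) =
      - (indicator (E p) z - indicator (E (p + \<tau>\<^sub>1)) z - indicator (E (p + \<tau>\<^sub>2)) z
        + indicator (E (p + \<tau>\<^sub>2 + \<tau>\<^sub>1)) z :: real)"
    proof (cases "z \<in> F")
      case True
      then have "z \<notin> E (p + \<tau>\<^sub>2)" "z \<notin> E (p + \<tau>\<^sub>2 + \<tau>\<^sub>1)"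
        using disj sub by blast+
      with facet[OF n(1) ne vn n(2,3) True face[OF edges(1)] face[OF edges(2)] sub(1,2)] show ?thesis
        by (auto simp: indicator_def)
    next
      case notF: False
      then have notE: "z \<notin> E p" "z \<notin> E (p + \<tau>\<^sub>1)"
        using sub by blast+
      show ?thesis
      proof (cases "z \<in> opposite_face c F")
        case True
        with notE facet[OF mn(1,2,3) low opp True face[OF edges(3)] face[OF edges(4)] sub(3,4)] show ?thesis
          by (auto simp: indicator_def)
      next
        case False
        then have notE': "z \<notin> E (p + \<tau>\<^sub>2)" "z \<notin> E (p + \<tau>\<^sub>2 + \<tau>\<^sub>1)"
          using sub by blast+
        show ?thesis
        proof (cases "z \<in> P")
          case zP: True
          have "n \<bullet> z \<noteq> d" "n \<bullet> z \<le> d" "n \<bullet> z \<noteq> d'" "n \<bullet> z \<ge> d'"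
            using zP notF False n low unfolding opp by auto
          moreover have "p \<in> P" "n \<bullet> p = d" "p + \<tau>\<^sub>2 \<in> P" "n \<bullet> (p + \<tau>\<^sub>2) = d'"
          proof -
            have "p \<in> F" "p + \<tau>\<^sub>2 \<in> opposite_face c F"
              using sub end_in by blast+
            then have "p \<in> P" "n \<bullet> p = d" "p + \<tau>\<^sub>2 \<in> P" "(- n) \<bullet> (p + \<tau>\<^sub>2) = - d'"
              using n(3) opp by blast+
            then show "p \<in> P" "n \<bullet> p = d" "p + \<tau>\<^sub>2 \<in> P" "n \<bullet> (p + \<tau>\<^sub>2) = d'"
              by simp_all
          qed
          ultimately have "n \<bullet> z < n \<bullet> p" "n \<bullet> (p + \<tau>\<^sub>2) < n \<bullet> z" and inP: "p \<in> P" "p + \<tau>\<^sub>2 \<in> P"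
            by auto
          then have "enters H z v n \<longleftrightarrow> enters H z v (- n)" "enters H z (- v) n \<longleftrightarrow> enters H z (- v) (- n)"
            using enters_off_facets_iff[OF dim e v n(1) ev ne vn H P generic zP inP(1) _ inP(2)]
              enters_off_facets_iff[OF dim e mv(1) n(1) mv(2) ne mv(3) H P generic zP inP(1) _ inP(2)]
            by blast+
          then show ?thesis
            using notE notE' by simp
        next
          case False
          then show ?thesis
            using notE notE' not_enters_outside[OF False[unfolded P]] by simp
        qed
      qed
    qed
  qed
qed

text \<open>One pair \<open>a\<close>, \<open>b\<close> works for all of the finitely many nearby
  translates at once and moves \<open>x\<close> to a point \<open>y\<close> off their bounding
  hyperplanes, where the count is exactly \<open>k\<close>. The shift is shorter than 1, which turns
  the radius \<open>R + 1\<close> about \<open>y\<close> into \<open>R + 2\<close> about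
  \<open>x\<close>.\<close>

lemma multi_tiles_enters_sum:
  fixes P :: "'a::euclidean_space set"
  assumes tiles: "multi_tiles P k m"
    and fin: "\<And>y R. finite {l. m l > 0 \<and> norm (y - l) \<le> R}"
    and R: "P \<subseteq> cball 0 R"
    and H: "finite H" "P = {z. \<forall>(w, c)\<in>H. w \<bullet> z \<le> c}"
    and nd: "\<And>l. m l > 0 \<Longrightarrow> nondegenerate H (x - l) v n"
  shows "(\<Sum>l | m l > 0 \<and> norm (x - l) \<le> R + 2. real (m l) * of_bool (enters H (x - l) v n)) = k"
proof -
  let ?L = "{l. m l > 0 \<and> norm (x - l) \<le> R + 2}"
  have "\<forall>\<^sub>F a in at_right (0::real). \<forall>\<^sub>F b in at_right (0::real). \<forall>l\<in>?L.
    (\<forall>(w, c)\<in>H. w \<bullet> (x - l + a *\<^sub>R v + b *\<^sub>R n) \<noteq> c) \<and>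
    ((\<forall>(w, c)\<in>H. w \<bullet> (x - l + a *\<^sub>R v + b *\<^sub>R n) \<le> c) \<longleftrightarrow> enters H (x - l) v n)"
    unfolding eventually_ball_finite_distrib[OF fin] using eventually_enters[OF H(1) nd] by blast
  moreover have "\<forall>\<^sub>F a in at_right (0::real). \<forall>\<^sub>F b in at_right (0::real). norm (a *\<^sub>R v) + norm (b *\<^sub>R n) < 1"
  proof -
    have lim: "((\<lambda>a. norm (a *\<^sub>R u)) \<longlongrightarrow> 0) (at_right (0::real))" for u :: 'a
      by (rule tendsto_norm_zero) (auto intro!: tendsto_eq_intros)
    have small: "\<forall>\<^sub>F a in at_right (0::real). norm (a *\<^sub>R u) < 1 / 2" for u :: 'a
      by (rule order_tendstoD(2)[OF lim]) simp
    show ?thesis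
      using small[of v]
    proof eventually_elim
      case (elim a)
      from small[of n] show ?case
        by eventually_elim (use elim in linarith)
    qed
  qed
  ultimately have "\<forall>\<^sub>F a in at_right (0::real). \<forall>\<^sub>F b in at_right (0::real). (\<forall>l\<in>?L.
    (\<forall>(w, c)\<in>H. w \<bullet> (x - l + a *\<^sub>R v + b *\<^sub>R n) \<noteq> c) \<and>
    ((\<forall>(w, c)\<in>H. w \<bullet> (x - l + a *\<^sub>R v + b *\<^sub>R n) \<le> c) \<longleftrightarrow> enters H (x - l) v n)) \<and>
    norm (a *\<^sub>R v) + norm (b *\<^sub>R n) < 1"
    by (simp only: eventually_conj_iff)
  then obtain a b where ab: "\<And>l w c. l \<in> ?L \<Longrightarrow> (w, c) \<in> H \<Longrightarrow> w \<bullet> (x - l + a *\<^sub>R v + b *\<^sub>R n) \<noteq> c"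
    "\<And>l. l \<in> ?L \<Longrightarrow> x - l + a *\<^sub>R v + b *\<^sub>R n \<in> P \<longleftrightarrow> enters H (x - l) v n"
    "norm (a *\<^sub>R v) + norm (b *\<^sub>R n) < 1"
    using H(2) by (elim eventually_at_right_nested_ex) blast
  define y where "y = x + a *\<^sub>R v + b *\<^sub>R n"
  have y: "y - l = x - l + a *\<^sub>R v + b *\<^sub>R n" for l
    by (simp add: y_def)
  have near: "norm (x - l) \<le> norm (y - l) + 1" for l
  proof -
    have "x - l = (y - l) - (a *\<^sub>R v + b *\<^sub>R n)"
      by (simp add: y_def)
    then have "norm (x - l) \<le> norm (y - l) + norm (a *\<^sub>R v + b *\<^sub>R n)"
      by (metis norm_triangle_ineq4)
    then show ?thesis
      using ab(3) norm_triangle_ineq[of "a *\<^sub>R v" "b *\<^sub>R n"] by linarith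
  qed
  have sub: "{l. m l > 0 \<and> norm (y - l) \<le> R + 1} \<subseteq> ?L"
  proof clarify
    fix l assume "norm (y - l) \<le> R + 1"
    with near[of l] show "norm (x - l) \<le> R + 2"
      by linarith
  qed
  have "real k = (\<Sum>l | m l > 0 \<and> norm (y - l) \<le> R + 1. real (m l) * indicator P (y - l))"
    using sub ab(1) by (intro multi_tiles_count[OF tiles fin R H, symmetric]) (auto simp: y)
  also have "\<dots> = (\<Sum>l\<in>?L. real (m l) * indicator P (y - l))"
  proof (rule sum.mono_neutral_left[OF fin sub], rule ballI)
    fix l assume "l \<in> ?L - {l. m l > 0 \<and> norm (y - l) \<le> R + 1}"
    then have "y - l \<notin> P"
      using R by auto
    then show "real (m l) * indicator P (y - l) = 0"
      by simp
  qed
  also have "\<dots> = (\<Sum>l\<in>?L. real (m l) * of_bool (enters H (x - l) v n))"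
    using ab(2) by (intro sum.cong) (auto simp: y indicator_def)
  finally show ?thesis
    by simp
qed

text \<open>All four shifted counts equal \<open>k\<close>, so their second difference is
  \<open>k - k - k + k = 0\<close>; exchanging it with the finite sum over translates leaves the
  signed legs.\<close>

lemma four_legged_frame_sum_eq_0:
  fixes P :: "'a::euclidean_space set"
  assumes dim: "DIM('a) = 3" and poly: "polytope P"
    and tiles: "multi_tiles P k m"
    and fin: "\<And>y R. finite {l. m l > 0 \<and> norm (y - l) \<le> R}"
    and R: "P \<subseteq> cball 0 R"
    and H: "finite H" "\<forall>(w, c)\<in>H. w \<noteq> 0" and P: "P = {z. \<forall>(w, c)\<in>H. w \<bullet> z \<le> c}"
    and full: "\<forall>n d. n \<noteq> 0 \<longrightarrow> \<not> P \<subseteq> {x. n \<bullet> x = d}"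
    and frame: "four_legged_frame P e \<tau>\<^sub>1 \<tau>\<^sub>2" and \<tau>: "\<tau>\<^sub>1 \<noteq> 0"
  obtains p where
    "\<And>x. (\<And>l. m l > 0 \<Longrightarrow> generic H e (x - l)) \<Longrightarrow>
      (\<Sum>l | m l > 0 \<and> norm (x - l) \<le> R + 2. real (m l) *
      (indicator (closed_segment p (p + e)) (x - l)
        - indicator (closed_segment (p + \<tau>\<^sub>1) (p + \<tau>\<^sub>1 + e)) (x - l)
        - indicator (closed_segment (p + \<tau>\<^sub>2) (p + \<tau>\<^sub>2 + e)) (x - l)
        + indicator (closed_segment (p + \<tau>\<^sub>2 + \<tau>\<^sub>1) (p + \<tau>\<^sub>2 + \<tau>\<^sub>1 + e)) (x - l))) = 0"
    "e \<noteq> 0"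
    "closed_segment p (p + e) \<union> closed_segment (p + \<tau>\<^sub>1) (p + \<tau>\<^sub>1 + e)
      \<union> closed_segment (p + \<tau>\<^sub>2) (p + \<tau>\<^sub>2 + e) \<union> closed_segment (p + \<tau>\<^sub>2 + \<tau>\<^sub>1) (p + \<tau>\<^sub>2 + \<tau>\<^sub>1 + e) \<subseteq> P"
proof (rule four_legged_second_difference[OF dim polytope_imp_polyhedron[OF poly] H P full frame \<tau>])
  fix p v n
  assume nz: "e \<noteq> 0" "v \<noteq> 0" "n \<noteq> 0" and orth: "e \<bullet> v = 0" "e \<bullet> n = 0" "v \<bullet> n = 0"
    and segs: "closed_segment p (p + e) \<union> closed_segment (p + \<tau>\<^sub>1) (p + \<tau>\<^sub>1 + e)
      \<union> closed_segment (p + \<tau>\<^sub>2) (p + \<tau>\<^sub>2 + e) \<union> closed_segment (p + \<tau>\<^sub>2 + \<tau>\<^sub>1) (p + \<tau>\<^sub>2 + \<tau>\<^sub>1 + e) \<subseteq> P"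
    and diff: "\<And>z. generic H e z \<Longrightarrow>
      of_bool (enters H z v n) - of_bool (enters H z v (- n))
        - of_bool (enters H z (- v) n) + of_bool (enters H z (- v) (- n)) =
      - (indicator (closed_segment p (p + e)) z
        - indicator (closed_segment (p + \<tau>\<^sub>1) (p + \<tau>\<^sub>1 + e)) z
        - indicator (closed_segment (p + \<tau>\<^sub>2) (p + \<tau>\<^sub>2 + e)) z
        + indicator (closed_segment (p + \<tau>\<^sub>2 + \<tau>\<^sub>1) (p + \<tau>\<^sub>2 + \<tau>\<^sub>1 + e)) z :: real)"
  show ?thesis
  proof (rule that[OF _ nz(1) segs])
    fix x assume gen: "\<And>l. m l > 0 \<Longrightarrow> generic H e (x - l)"
    let ?L = "{l. m l > 0 \<and> norm (x - l) \<le> R + 2}"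
    let ?S = "\<lambda>v n. \<Sum>l\<in>?L. real (m l) * of_bool (enters H (x - l) v n)"
    have nd: "nondegenerate H (x - l) v n" "nondegenerate H (x - l) (- v) n"
      "nondegenerate H (x - l) v (- n)" "nondegenerate H (x - l) (- v) (- n)" if "m l > 0" for l
    proof -
      show "nondegenerate H (x - l) v n"
        by (rule generic_nondegenerate[OF dim nz orth H P gen[OF that]])
      then show "nondegenerate H (x - l) (- v) n"
        "nondegenerate H (x - l) v (- n)" "nondegenerate H (x - l) (- v) (- n)"
        by (simp_all add: nondegenerate_def)
    qed
    have "?S v n = k" "?S v (- n) = k" "?S (- v) n = k" "?S (- v) (- n) = k"
      using nd by (intro multi_tiles_enters_sum[OF tiles fin R H(1) P]; blast)+
    then have "?S v n - ?S v (- n) - ?S (- v) n + ?S (- v) (- n) = 0"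
      by simp
    also have "?S v n - ?S v (- n) - ?S (- v) n + ?S (- v) (- n) =
      (\<Sum>l\<in>?L. real (m l) * (of_bool (enters H (x - l) v n) - of_bool (enters H (x - l) v (- n))
        - of_bool (enters H (x - l) (- v) n) + of_bool (enters H (x - l) (- v) (- n))))"
      by (simp only: sum.distrib sum_subtractf ring_distribs)
    also have "\<dots> = (\<Sum>l\<in>?L. real (m l) * - (indicator (closed_segment p (p + e)) (x - l)
        - indicator (closed_segment (p + \<tau>\<^sub>1) (p + \<tau>\<^sub>1 + e)) (x - l)
        - indicator (closed_segment (p + \<tau>\<^sub>2) (p + \<tau>\<^sub>2 + e)) (x - l)
        + indicator (closed_segment (p + \<tau>\<^sub>2 + \<tau>\<^sub>1) (p + \<tau>\<^sub>2 + \<tau>\<^sub>1 + e)) (x - l)))"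
      using gen by (intro sum.cong refl) (subst diff, auto)
    finally show "(\<Sum>l\<in>?L. real (m l) *
      (indicator (closed_segment p (p + e)) (x - l)
        - indicator (closed_segment (p + \<tau>\<^sub>1) (p + \<tau>\<^sub>1 + e)) (x - l)
        - indicator (closed_segment (p + \<tau>\<^sub>2) (p + \<tau>\<^sub>2 + e)) (x - l)
        + indicator (closed_segment (p + \<tau>\<^sub>2 + \<tau>\<^sub>1) (p + \<tau>\<^sub>2 + \<tau>\<^sub>1 + e)) (x - l))) = 0"
      by (simp only: mult_minus_right sum_negf neg_equal_0_iff_equal)
  qed
qed

subsection \<open>Integration along the legs\<close>

text \<open>Unconditional summation allows the index set to be partitioned into the fibres of
  \<open>r\<close>. They will be the segments carried by one line, which is where the cancellation
  takes place.\<close>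

lemma infsum_fibres_eq_0:
  fixes g :: "'i \<Rightarrow> 'b::banach"
  assumes "g summable_on I" and fibre: "\<And>\<rho>. \<rho> \<in> r ` I \<Longrightarrow> infsum g {i \<in> I. r i = \<rho>} = 0"
  shows "infsum g I = 0"
proof -
  let ?S = "Sigma (r ` I) (\<lambda>\<rho>. {i \<in> I. r i = \<rho>})"
  have bij: "bij_betw snd ?S I"
    by (rule bij_betwI[where g = "\<lambda>i. (r i, i)"]) auto
  have "(\<lambda>p. g (snd p)) summable_on ?S"
    using assms(1) by (subst summable_on_reindex_bij_betw[OF bij])
  then have "infsum (\<lambda>p. g (snd p)) ?S = infsum (\<lambda>\<rho>. infsum (\<lambda>i. g (snd (\<rho>, i))) {i \<in> I. r i = \<rho>}) (r ` I)"
    by (rule infsum_Sigma_banach[symmetric])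
  also have "\<dots> = 0"
    by (rule infsum_0) (simp add: fibre)
  finally show ?thesis
    by (simp add: infsum_reindex_bij_betw[OF bij])
qed

lemma summable_norm_iff_integrable:
  fixes f :: "'i \<Rightarrow> 'b::{banach, second_countable_topology}"
  shows "(\<lambda>i. norm (f i)) summable_on I \<longleftrightarrow> integrable (count_space I) f"
  using abs_summable_equivalent[of f I] by (simp add: Infinite_Set_Sum.abs_summable_on_def)

text \<open>Fubini for counting measure times Lebesgue measure, justified by the summable integrals
  of the norms. It turns cancellation at almost every parameter \<open>u\<close> into cancellation
  of the integrals.\<close>

lemma infsum_integral_eq_0:
  fixes h :: "'i \<Rightarrow> real \<Rightarrow> complex"
  assumes I: "countable I"
    and int: "\<And>i. i \<in> I \<Longrightarrow> integrable lborel (h i)"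
    and summ: "(\<lambda>i. LINT u|lborel. norm (h i u)) summable_on I"
    and zero: "AE u in lborel. (\<exists>S. finite S \<and> S \<subseteq> I \<and> (\<forall>i\<in>I - S. h i u = 0) \<and> (\<Sum>i\<in>S. h i u) = 0)"
  shows "(\<Sum>\<^sub>\<infinity>i\<in>I. LINT u|lborel. h i u) = 0"
proof -
  interpret C: sigma_finite_measure "count_space I"
    using I by (rule sigma_finite_measure_count_space_countable)
  interpret pair_sigma_finite "count_space I" "lborel :: real measure" ..
  have norm_int: "integrable (count_space I) (\<lambda>i. LINT u|lborel. norm (h i u))"
    unfolding summable_norm_iff_integrable[symmetric] using summ by simp
  have int_int: "integrable (count_space I) (\<lambda>i. LINT u|lborel. h i u)"
    by (rule Bochner_Integration.integrable_bound[OF norm_int]) (auto simp: integral_norm_bound)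
  have meas: "case_prod h \<in> borel_measurable (count_space I \<Otimes>\<^sub>M lborel)"
    using I int by (intro measurable_pair_measure_countable1) auto
  have "integrable (count_space I \<Otimes>\<^sub>M lborel) (case_prod h)"
    using norm_int int by (intro Fubini_integrable meas) (auto simp: AE_count_space)
  then have "(LINT i|count_space I. LINT u|lborel. h i u) = (LINT u|lborel. LINT i|count_space I. h i u)"
    by (rule Fubini_integral[symmetric])
  also have "\<dots> = (LINT u|(lborel :: real measure). 0)"
  proof (rule integral_cong_AE)
    show "(\<lambda>u. LINT i|count_space I. h i u) \<in> borel_measurable lborel"
      using meas by (intro C.borel_measurable_lebesgue_integral) (simp add: measurable_pair_swap_iff[symmetric])
    show "AE u in lborel. (LINT i|count_space I. h i u) = 0"
      using zero
    proof eventually_elim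
      case (elim u)
      then obtain S where S: "finite S" "S \<subseteq> I" "\<forall>i\<in>I - S. h i u = 0" "(\<Sum>i\<in>S. h i u) = 0"
        by blast
      have "(LINT i|count_space I. h i u) = infsetsum (\<lambda>i. h i u) I"
        by (simp add: infsetsum_def)
      also have "\<dots> = infsetsum (\<lambda>i. h i u) S"
        using S by (intro infsetsum_cong_neutral) auto
      finally show ?case
        using S by simp
    qed
  qed simp
  finally have "infsetsum (\<lambda>i. LINT u|lborel. h i u) I = 0"
    by (simp add: infsetsum_def)
  then show ?thesis
    using infsetsum_infsum[of "\<lambda>i. LINT u|lborel. h i u" I] int_int
    by (simp add: Infinite_Set_Sum.abs_summable_on_def)
qed

text \<open>On one line parallel to \<open>e\<close>, the integrands of all its segments cancel at
  each point off \<open>B\<close>, and \<open>B\<close> meets that line in a null set. The pairs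
  \<open>(l, j)\<close> are grouped by lines, and the weight supplies the convergence needed for
  grouping and integrating.\<close>

lemma signed_segments_sum_eq_0:
  fixes f :: "'a::euclidean_space \<Rightarrow> complex" and q :: "'j \<Rightarrow> 'a" and \<epsilon> :: "'j \<Rightarrow> real"
  assumes e: "e \<noteq> 0" and f [measurable]: "f \<in> borel_measurable borel"
    and K: "K \<ge> 0" "\<And>x. norm (f x) \<le> K * decay x"
    and summ: "(\<lambda>l. of_nat (m l) * decay l) summable_on UNIV" and cnt: "countable {l. m l > 0}"
    and J: "finite J" and R: "\<And>j. j \<in> J \<Longrightarrow> closed_segment (q j) (q j + e) \<subseteq> cball 0 R"
    and null: "\<And>\<rho>. AE u in lborel. \<rho> + u *\<^sub>R e \<notin> B"
    and zero: "\<And>x. x \<notin> B \<Longrightarrow> (\<Sum>l | m l > 0 \<and> norm (x - l) \<le> R. real (m l) *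
      (\<Sum>j\<in>J. \<epsilon> j * indicator (closed_segment (q j) (q j + e)) (x - l))) = 0"
  shows "(\<Sum>\<^sub>\<infinity>l. of_nat (m l) * (\<Sum>j\<in>J. of_real (\<epsilon> j) *
      (LINT s|lborel. indicator {0..1} s *\<^sub>R f (l + q j + s *\<^sub>R e)))) = 0"
proof -
  define \<Lambda> where "\<Lambda> = {l. m l > 0}"
  \<comment> \<open>The segment of index \<open>i = (l, j)\<close> is \<open>{r i + u *\<^sub>R e | u. t i \<le> u \<le> t i + 1}\<close> with \<open>r i\<close> orthogonal
    to \<open>e\<close>, so that two segments lie on the same line iff they have the same \<open>r i\<close>.\<close>
  define t where "t i = (fst i + q (snd i)) \<bullet> e / (e \<bullet> e)" for i
  define r where "r i = fst i + q (snd i) - t i *\<^sub>R e" for i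
  define I where "I = \<Lambda> \<times> J"
  define h where "h i u = of_real (m (fst i) * \<epsilon> (snd i)) * (indicator {t i..t i + 1} u *\<^sub>R f (r i + u *\<^sub>R e))" for i u
  define C where "C = (2 * (1 + R\<^sup>2)) ^ DIM('a)"
  \<comment> \<open>A bound for the integral of \<open>norm (h i u)\<close> over \<open>u\<close>:
    the parameter interval of a leg has length 1, and its points are within \<open>R\<close> of
    \<open>fst i\<close>, where the weight changes by at most the factor \<open>C\<close>.\<close>
  define G where "G i = m (fst i) * \<bar>\<epsilon> (snd i)\<bar> * (K * (C * decay (fst i)))" for i
  have C: "C \<ge> 0"
    by (simp add: C_def)
  have [measurable]: "h i \<in> borel_measurable borel" for i
    unfolding h_def by measurable
  have seg: "r i + u *\<^sub>R e - fst i \<in> closed_segment (q (snd i)) (q (snd i) + e)"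
    if "t i \<le> u" "u \<le> t i + 1" for i u
    unfolding in_segment
    by (rule exI[of _ "u - t i"]) (use that in \<open>auto simp: r_def algebra_simps\<close>)
  have h_le: "norm (h i u) \<le> G i * indicator {t i..t i + 1} u" if "i \<in> I" for i u
  proof (cases "u \<in> {t i..t i + 1}")
    case True
    let ?y = "r i + u *\<^sub>R e"
    have "?y - fst i \<in> cball 0 R"
    proof (rule subsetD[OF R])
      show "snd i \<in> J"
        using that by (auto simp: I_def)
    qed (use seg True in auto)
    then have "norm (fst i - ?y) \<le> R"
      by (simp add: norm_minus_commute[of "fst i"])
    then have "decay ?y \<le> C * decay (fst i)"
      unfolding C_def by (rule decay_le_add)
    then have "norm (f ?y) \<le> K * (C * decay (fst i))"
      using K(2)[of ?y] mult_left_mono[OF _ K(1)] order_trans by blast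
    then have "(m (fst i) * \<bar>\<epsilon> (snd i)\<bar>) * norm (f ?y) \<le> (m (fst i) * \<bar>\<epsilon> (snd i)\<bar>) * (K * (C * decay (fst i)))"
      by (rule mult_left_mono) simp
    then show ?thesis
      using True by (simp add: h_def G_def norm_mult abs_mult)
  qed (simp add: h_def)
  have h_int: "integrable lborel (h i)" if "i \<in> I" for i
    by (rule Bochner_Integration.integrable_bound[where f = "\<lambda>u. G i * indicator {t i..t i + 1} u"])
      (use h_le[OF that] in \<open>auto intro!: integrable_mult_right integrable_real_indicator AE_I2 order_trans[OF _ abs_ge_self]\<close>)
  have h_norm: "(LINT u|lborel. norm (h i u)) \<le> G i" if "i \<in> I" for i
  proof -
    have "(LINT u|lborel. norm (h i u)) \<le> (LINT u|lborel. G i * indicator {t i..t i + 1} u)"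
      using h_le[OF that] h_int[OF that] by (intro integral_mono) (auto intro!: integrable_mult_right integrable_real_indicator)
    then show ?thesis
      by simp
  qed
  have "(\<lambda>i. norm (G i)) summable_on (UNIV \<times> J)"
  proof (rule Infinite_Sum.abs_summable_on_Sigma_iff[THEN iffD2], intro conjI ballI)
    fix l
    show "(\<lambda>j. norm (G (l, j))) summable_on J"
      using J by simp
  next
    have "(\<lambda>l. (\<Sum>j\<in>J. \<bar>\<epsilon> j\<bar> * (K * C)) * (of_nat (m l) * decay l)) summable_on UNIV"
      by (intro summable_on_cmult_right summ)
    also have "(\<lambda>l. (\<Sum>j\<in>J. \<bar>\<epsilon> j\<bar> * (K * C)) * (of_nat (m l) * decay l)) =
        (\<lambda>l. norm (infsum (\<lambda>j. norm (G (l, j))) J))"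
    proof
      fix l
      have G: "norm (G (l, j)) = \<bar>\<epsilon> j\<bar> * (K * C) * (of_nat (m l) * decay l)" for j
        using K(1) C abs_of_pos[OF decay_pos[of l]] by (simp add: G_def abs_mult mult_ac)
      show "(\<Sum>j\<in>J. \<bar>\<epsilon> j\<bar> * (K * C)) * (of_nat (m l) * decay l) =
          norm (infsum (\<lambda>j. norm (G (l, j))) J)"
        unfolding G infsum_finite[OF J] sum_distrib_right[symmetric]
        using K(1) C abs_of_pos[OF decay_pos[of l]] by (simp add: abs_mult sum_nonneg)
    qed
    finally show "(\<lambda>l. norm (infsum (\<lambda>j. norm (G (l, j))) J)) summable_on UNIV" .
  qed
  then have G_summ: "(\<lambda>i. norm (G i)) summable_on A" if "A \<subseteq> I" for A
    using that by (rule summable_on_subset_banach[OF _ order_trans]) (auto simp: I_def)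
  have norm_summ: "(\<lambda>i. LINT u|lborel. norm (h i u)) summable_on A" if "A \<subseteq> I" for A
    by (rule summable_on_comparison_test[OF G_summ[OF that]])
      (use that h_norm in \<open>auto intro: order_trans[OF _ abs_ge_self]\<close>)
  have g_summ: "(\<lambda>i. LINT u|lborel. h i u) summable_on I"
    by (rule Infinite_Sum.abs_summable_summable, rule summable_on_comparison_test[OF norm_summ[OF order_refl]])
      (auto intro: integral_norm_bound)
  have I_cnt: "countable I"
    using cnt J by (auto simp: I_def \<Lambda>_def countable_finite)
  have r_e: "r i \<bullet> e = 0" for i
    using e by (simp add: r_def t_def inner_diff_left)
  have fin: "finite {l. m l > 0 \<and> norm (y - l) \<le> R}" for y
    by (rule summable_decay_locally_finite[OF summ])
  have "infsum (\<lambda>i. LINT u|lborel. h i u) {i \<in> I. r i = \<rho>} = 0" if \<rho>: "\<rho> \<in> r ` I" for \<rho>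
  proof (rule infsum_integral_eq_0)
    show "countable {i \<in> I. r i = \<rho>}"
      using I_cnt by (rule countable_subset[rotated]) auto
    show "integrable lborel (h i)" if "i \<in> {i \<in> I. r i = \<rho>}" for i
      using h_int that by blast
    show "(\<lambda>i. LINT u|lborel. norm (h i u)) summable_on {i \<in> I. r i = \<rho>}"
      by (rule norm_summ) auto
    show "AE u in lborel. \<exists>S. finite S \<and> S \<subseteq> {i \<in> I. r i = \<rho>} \<and>
        (\<forall>i\<in>{i \<in> I. r i = \<rho>} - S. h i u = 0) \<and> (\<Sum>i\<in>S. h i u) = 0"
      using null[of \<rho>]
    proof eventually_elim
      case (elim u)
      define x where "x = \<rho> + u *\<^sub>R e"
      let ?L = "{l. m l > 0 \<and> norm (x - l) \<le> R}"
      let ?S = "{i \<in> ?L \<times> J. r i = \<rho>}"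
      let ?k = "\<lambda>i. real (m (fst i)) * \<epsilon> (snd i) * indicator (closed_segment (q (snd i)) (q (snd i) + e)) (x - fst i)"
      have finS: "finite ?S"
        by (rule finite_subset[OF _ finite_cartesian_product[OF fin[of x] J]]) auto
      \<comment> \<open>On the line with offset \<open>\<rho>\<close>, the parameter interval of
        \<open>i\<close> is the trace of its segment, and every integrand carries the same value
        \<open>f x\<close>. With this common factor taken out, only the real coefficients have to
        cancel.\<close>
      have h_k: "h i u = of_real (?k i) * f x" if "r i = \<rho>" for i
      proof -
        have "x - fst i \<in> closed_segment (q (snd i)) (q (snd i) + e) \<longleftrightarrow> u \<in> {t i..t i + 1}"
        proof
          assume "x - fst i \<in> closed_segment (q (snd i)) (q (snd i) + e)"
          then obtain s where s: "x - fst i = (1 - s) *\<^sub>R q (snd i) + s *\<^sub>R (q (snd i) + e)" "0 \<le> s" "s \<le> 1"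
            by (auto simp: in_segment)
          have "u *\<^sub>R e = (x - fst i) + fst i - r i"
            using that by (simp add: x_def)
          also have "\<dots> = (t i + s) *\<^sub>R e"
            by (simp add: s(1) r_def algebra_simps)
          finally have "u *\<^sub>R e = (t i + s) *\<^sub>R e" .
          then show "u \<in> {t i..t i + 1}"
            using e s by simp
        next
          assume "u \<in> {t i..t i + 1}"
          then show "x - fst i \<in> closed_segment (q (snd i)) (q (snd i) + e)"
            using seg[of i u] that by (simp add: x_def)
        qed
        then show ?thesis
          using that by (simp add: h_def x_def indicator_def)
      qed
      have "h i u = 0" if i: "i \<in> {i \<in> I. r i = \<rho>} - ?S" for i
      proof -
        have "x - fst i \<notin> closed_segment (q (snd i)) (q (snd i) + e)"
          using i R[of "snd i"] by (auto simp: I_def \<Lambda>_def mem_Times_iff)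
        then show ?thesis
          using h_k i by simp
      qed
      moreover have "(\<Sum>i\<in>?S. h i u) = 0"
      proof -
        \<comment> \<open>A segment through \<open>x\<close> lies on the line of \<open>x\<close>:
          the two offsets are orthogonal to \<open>e\<close> and differ by a multiple of
          \<open>e\<close>, so they agree. All other indices contribute 0.\<close>
        have "(\<Sum>i\<in>?S. ?k i) = (\<Sum>i\<in>?L \<times> J. ?k i)"
        proof (rule sum.mono_neutral_left)
          show "\<forall>i\<in>?L \<times> J - ?S. ?k i = 0"
          proof
            fix i assume i: "i \<in> ?L \<times> J - ?S"
            have "x - fst i \<notin> closed_segment (q (snd i)) (q (snd i) + e)"
            proof
              assume "x - fst i \<in> closed_segment (q (snd i)) (q (snd i) + e)"
              then obtain s where s: "x - fst i = (1 - s) *\<^sub>R q (snd i) + s *\<^sub>R (q (snd i) + e)"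
                by (auto simp: in_segment)
              then have eq: "\<rho> = r i + (t i + s - u) *\<^sub>R e"
                by (simp add: x_def r_def algebra_simps)
              moreover have "\<rho> \<bullet> e = 0"
                using \<rho> r_e by auto
              ultimately have "(t i + s - u) * (e \<bullet> e) = 0"
                using r_e[of i] by (metis add_0 inner_add_left inner_scaleR_left)
              then have "\<rho> = r i"
                using eq e by simp
              then show False
                using i by blast
            qed
            then show "?k i = 0"
              by simp
          qed
        qed (use finite_cartesian_product[OF fin[of x] J] in auto)
        also have "\<dots> = (\<Sum>l\<in>?L. \<Sum>j\<in>J. ?k (l, j))"
          by (simp add: sum.cartesian_product case_prod_unfold)
        also have "\<dots> = 0"
          using zero[of x] elim by (simp add: x_def sum_distrib_left mult.assoc)
        finally have "(\<Sum>i\<in>?S. ?k i) = 0" .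
        moreover have "(\<Sum>i\<in>?S. h i u) = of_real (\<Sum>i\<in>?S. ?k i) * f x"
          unfolding of_real_sum sum_distrib_right by (rule sum.cong[OF refl]) (rule h_k, blast)
        ultimately show ?thesis
          by simp
      qed
      ultimately show ?case
        using finS by (intro exI[of _ ?S]) (auto simp: I_def \<Lambda>_def)
    qed
  qed
  then have "infsum (\<lambda>i. LINT u|lborel. h i u) I = 0"
    by (rule infsum_fibres_eq_0[OF g_summ])
  also have "infsum (\<lambda>i. LINT u|lborel. h i u) I =
      (\<Sum>\<^sub>\<infinity>l\<in>\<Lambda>. \<Sum>j\<in>J. LINT u|lborel. h (l, j) u)"
    unfolding I_def using g_summ J by (subst infsum_Sigma_banach[symmetric]) (auto simp: I_def)
  also have "\<dots> = (\<Sum>\<^sub>\<infinity>l. of_nat (m l) * (\<Sum>j\<in>J. of_real (\<epsilon> j) *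
      (LINT s|lborel. indicator {0..1} s *\<^sub>R f (l + q j + s *\<^sub>R e))))"
  proof (rule infsum_cong_neutral)
    fix l
    have "(LINT u|lborel. h (l, j) u) = of_nat (m l) * (of_real (\<epsilon> j) *
        (LINT s|lborel. indicator {0..1} s *\<^sub>R f (l + q j + s *\<^sub>R e)))" for j
    proof -
      let ?i = "(l, j)"
      have "(LINT u|lborel. indicator {t ?i..t ?i + 1} u *\<^sub>R f (r ?i + u *\<^sub>R e)) =
          (LINT s|lborel. indicator {t ?i..t ?i + 1} (t ?i + 1 * s) *\<^sub>R f (r ?i + (t ?i + 1 * s) *\<^sub>R e))"
        by (subst lborel_integral_real_affine[where c = 1 and t = "t ?i"]) simp_all
      also have "\<dots> = (LINT s|lborel. indicator {0..1} s *\<^sub>R f (l + q j + s *\<^sub>R e))"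
        by (intro Bochner_Integration.integral_cong refl arg_cong2[where f = scaleR] arg_cong[where f = f])
          (auto simp: indicator_def r_def algebra_simps)
      finally have shift: "(LINT u|lborel. indicator {t ?i..t ?i + 1} u *\<^sub>R f (r ?i + u *\<^sub>R e)) =
          (LINT s|lborel. indicator {0..1} s *\<^sub>R f (l + q j + s *\<^sub>R e))" .
      have "(LINT u|lborel. h ?i u) = of_real (m l * \<epsilon> j) *
          (LINT u|lborel. indicator {t ?i..t ?i + 1} u *\<^sub>R f (r ?i + u *\<^sub>R e))"
        unfolding h_def fst_conv snd_conv by (rule integral_mult_right_zero)
      then show ?thesis
        unfolding shift by (simp add: mult.assoc)
    qed
    then show "(\<Sum>j\<in>J. LINT u|lborel. h (l, j) u) = of_nat (m l) * (\<Sum>j\<in>J. of_real (\<epsilon> j) *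
        (LINT s|lborel. indicator {0..1} s *\<^sub>R f (l + q j + s *\<^sub>R e)))"
      by (simp add: sum_distrib_left)
  qed (auto simp: \<Lambda>_def)
  finally show ?thesis .
qed

subsection \<open>The symbol of a frame\<close>

text \<open>The entire extension of \<open>z \<mapsto> (1 - exp (- 2\<pi>\<i>z)) / (2\<pi>\<i>z)\<close>, written in the form in which
  \<open>pole_lemma\<close> states the removal of the singularity at \<open>0\<close>.\<close>

definition sinc_entire :: "complex \<Rightarrow> complex" where
  "sinc_entire z = (let F = \<lambda>z. exp (- (2 * of_real pi * \<i> * z)) / (- (2 * of_real pi * \<i>)) in
    if z = 0 then deriv F 0 else (F z - F 0) / (z - 0))"

lemma sinc_entire_holomorphic: "sinc_entire holomorphic_on UNIV"
  unfolding sinc_entire_def Let_def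
  by (rule pole_lemma) (auto intro!: holomorphic_intros)

lemma sinc_entire_0: "sinc_entire 0 = 1"
proof -
  have "((\<lambda>z. exp (- (2 * of_real pi * \<i> * z)) / (- (2 * of_real pi * \<i>))) has_field_derivative 1) (at 0)"
    by (auto intro!: derivative_eq_intros)
  from DERIV_imp_deriv[OF this] show ?thesis
    by (simp add: sinc_entire_def)
qed

lemma integral_character_interval:
  "(LINT s|lborel. indicator {0..1} s *\<^sub>R exp (- (2 * of_real pi * \<i> * of_real (s * t)))) = sinc_entire (of_real t)"
proof (cases "t = 0")
  case True
  have "(LINT s|lborel. indicator {0..1::real} s *\<^sub>R (1 :: complex)) = 1"
    by simp
  then show ?thesis
    by (simp only: True mult_zero_right of_real_0 minus_zero exp_zero sinc_entire_0)
next
  case False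
  let ?F = "\<lambda>s. exp (- (2 * of_real pi * \<i> * of_real (s * t))) / (- (2 * of_real pi * \<i> * of_real t))"
  have "(LINT s|lborel. indicator {0..1} s *\<^sub>R exp (- (2 * of_real pi * \<i> * of_real (s * t)))) = ?F 1 - ?F 0"
  proof (rule integral_FTC_atLeastAtMost)
    fix s :: real
    have "((\<lambda>z. exp (- (2 * of_real pi * \<i> * (z * of_real t))) / (- (2 * of_real pi * \<i> * of_real t)))
        has_field_derivative exp (- (2 * of_real pi * \<i> * of_real (s * t)))) (at (of_real s))"
      using False by (auto intro!: derivative_eq_intros)
    from has_vector_derivative_real_field[OF this]
    show "(?F has_vector_derivative exp (- (2 * of_real pi * \<i> * of_real (s * t)))) (at s within {0..1})"
      by (simp add: has_vector_derivative_at_within)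
  qed (auto intro!: continuous_intros)
  also have "\<dots> = sinc_entire (of_real t)"
    using False by (simp add: sinc_entire_def field_simps)
  finally show ?thesis .
qed

lemma exp_character_eq_1_iff:
  "exp (- (2 * of_real pi * \<i> * of_real t)) = (1::complex) \<longleftrightarrow> t \<in> \<int>"
proof -
  have "exp (- (2 * of_real pi * \<i> * of_real t)) = (1::complex) \<longleftrightarrow> (\<exists>n::int. t = - of_int n)"
  proof -
    have "- (2 * pi * t) = of_int (2 * n) * pi \<longleftrightarrow> t = - of_int n" for n
    proof -
      have "- (2 * pi * t) = of_int (2 * n) * pi \<longleftrightarrow> 2 * pi * (t + of_int n) = 0"
        by (auto simp: algebra_simps)
      then show ?thesis
        by (simp add: add_eq_0_iff2)
    qed
    then show ?thesis
      by (subst exp_eq_1) simp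
  qed
  also have "\<dots> \<longleftrightarrow> t \<in> \<int>"
    by (metis Ints_cases Ints_minus Ints_of_int minus_minus of_int_minus)
  finally show ?thesis .
qed

text \<open>The removable singularity at 0 has value 1, not 0. This is why the plane through 0 is
  absent from \<open>hyperplanes_nz\<close>.\<close>

lemma sinc_entire_nonzero:
  assumes "t \<notin> \<int> - {0}"
  shows "sinc_entire (of_real t) \<noteq> 0"
proof (cases "t = 0")
  case True
  then show ?thesis
    by (simp add: sinc_entire_0)
next
  case False
  then have "exp (- (2 * of_real pi * \<i> * of_real t)) \<noteq> (1::complex)"
    using assms by (subst exp_character_eq_1_iff) simp
  then show ?thesis
    using False by (auto simp: sinc_entire_def)
qed

section \<open>Averages of a transform along a segment\<close>

lemma borel_measurable_test_function:
  "test_function_on U \<psi> \<Longrightarrow> \<psi> \<in> borel_measurable borel"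
  unfolding test_function_on_def by (intro borel_measurable_continuous_onI smooth_continuous_on) simp

lemma borel_measurable_character [measurable (raw)]:
  assumes [measurable]: "f \<in> borel_measurable M"
  shows "(\<lambda>x. exp (- (2 * of_real pi * \<i> * of_real (f x))) :: complex) \<in> borel_measurable M"
proof -
  have "(\<lambda>t. exp (- (2 * of_real pi * \<i> * of_real t)) :: complex) \<in> borel_measurable borel"
    by (intro borel_measurable_continuous_onI continuous_intros)
  from measurable_compose[OF assms this] show ?thesis .
qed

lemma borel_measurable_fourier:
  fixes \<psi> :: "'a::euclidean_space \<Rightarrow> complex"
  assumes "test_function_on U \<psi>"
  shows "fourier \<psi> \<in> borel_measurable borel"
proof -
  have [measurable]: "\<psi> \<in> borel_measurable borel"
    using assms by (rule borel_measurable_test_function)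
  show ?thesis
    unfolding fourier_def[abs_def] by measurable
qed

text \<open>Fubini in the segment parameter and the variable of \<open>\<psi>\<close>: a translate
  of the transform is the transform of \<open>\<psi>\<close> times a character, and averaging these
  characters over the unit parameter interval gives \<open>sinc_entire\<close>. Integrability is
  recorded so that several segments can be combined linearly.\<close>

lemma fourier_mult_segment:
  fixes \<psi> :: "'a::euclidean_space \<Rightarrow> complex"
  assumes test: "test_function_on U \<psi>"
  shows "(LINT s|lborel. indicator {0..1} s *\<^sub>R fourier \<psi> (l + q + s *\<^sub>R e)) =
    fourier (\<lambda>x. \<psi> x * exp (- (2 * of_real pi * \<i> * of_real (x \<bullet> q))) * sinc_entire (of_real (x \<bullet> e))) l"
    "integrable lborel (\<lambda>x. \<psi> x * exp (- (2 * of_real pi * \<i> * of_real (x \<bullet> q))) * sinc_entire (of_real (x \<bullet> e))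
      * exp (- (2 * of_real pi * \<i> * of_real (l \<bullet> x))))"
proof -
  define f where "f s x = indicator {0..1::real} s *\<^sub>R (\<psi> x *
    exp (- (2 * of_real pi * \<i> * of_real ((l + q + s *\<^sub>R e) \<bullet> x))))" for s and x
  have [measurable]: "\<psi> \<in> borel_measurable borel"
    using test by (rule borel_measurable_test_function)
  have int: "integrable lborel \<psi>"
    using test by (rule test_function_integrable)
  have meas: "case_prod f \<in> borel_measurable (lborel \<Otimes>\<^sub>M lborel)"
    unfolding f_def by measurable
  have norm_f: "norm (f s x) = indicator {0..1} s * norm (\<psi> x)" for s x
    by (simp add: f_def norm_mult)
  have "integrable (lborel \<Otimes>\<^sub>M lborel) (case_prod f)"
  proof (rule lborel_pair.Fubini_integrable[OF meas])
    show "integrable lborel (\<lambda>s. LINT x|lborel. norm (case_prod f (s, x)))"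
      by (simp add: norm_f integrable_real_indicator)
    show "AE s in lborel. integrable lborel (\<lambda>x. case_prod f (s, x))"
    proof (rule AE_I2)
      fix s
      show "integrable lborel (\<lambda>x. case_prod f (s, x))"
        by (rule Bochner_Integration.integrable_bound[OF integrable_norm[OF int]])
          (use measurable_compose_Pair1[OF _ meas] in \<open>auto simp: norm_f indicator_def\<close>)
    qed
  qed
  note prod_int = this
  have inner_s: "(LINT s|lborel. f s x) =
      \<psi> x * exp (- (2 * of_real pi * \<i> * of_real (x \<bullet> q))) * sinc_entire (of_real (x \<bullet> e))
      * exp (- (2 * of_real pi * \<i> * of_real (l \<bullet> x)))" for x
  proof -
    have "f s x = (\<psi> x * exp (- (2 * of_real pi * \<i> * of_real (x \<bullet> q)))
        * exp (- (2 * of_real pi * \<i> * of_real (l \<bullet> x)))) *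
        (indicator {0..1} s *\<^sub>R exp (- (2 * of_real pi * \<i> * of_real (s * (x \<bullet> e)))))" for s
    proof -
      have "exp (- (2 * of_real pi * \<i> * of_real ((l + q + s *\<^sub>R e) \<bullet> x))) =
          exp (- (2 * of_real pi * \<i> * of_real (x \<bullet> q))) * exp (- (2 * of_real pi * \<i> * of_real (l \<bullet> x)))
            * exp (- (2 * of_real pi * \<i> * of_real (s * (x \<bullet> e))))"
        unfolding exp_add[symmetric]
        by (rule arg_cong[where f = exp]) (simp add: inner_add_left inner_commute algebra_simps)
      then show ?thesis
        unfolding f_def scaleR_conv_of_real by (simp only: mult_ac)
    qed
    then have "(LINT s|lborel. f s x) = (\<psi> x * exp (- (2 * of_real pi * \<i> * of_real (x \<bullet> q)))
        * exp (- (2 * of_real pi * \<i> * of_real (l \<bullet> x)))) *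
        (LINT s|lborel. indicator {0..1} s *\<^sub>R exp (- (2 * of_real pi * \<i> * of_real (s * (x \<bullet> e)))))"
      by (simp only: integral_mult_right_zero)
    then show ?thesis
      unfolding integral_character_interval by (simp only: mult_ac)
  qed
  have "(LINT s|lborel. indicator {0..1} s *\<^sub>R fourier \<psi> (l + q + s *\<^sub>R e)) = (LINT s|lborel. LINT x|lborel. f s x)"
    by (simp add: f_def fourier_def)
  also have "\<dots> = (LINT x|lborel. LINT s|lborel. f s x)"
    by (rule lborel_pair.Fubini_integral[OF prod_int, symmetric])
  finally show "(LINT s|lborel. indicator {0..1} s *\<^sub>R fourier \<psi> (l + q + s *\<^sub>R e)) =
    fourier (\<lambda>x. \<psi> x * exp (- (2 * of_real pi * \<i> * of_real (x \<bullet> q))) * sinc_entire (of_real (x \<bullet> e))) l"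
    by (simp add: inner_s fourier_def)
  show "integrable lborel (\<lambda>x. \<psi> x * exp (- (2 * of_real pi * \<i> * of_real (x \<bullet> q))) * sinc_entire (of_real (x \<bullet> e))
      * exp (- (2 * of_real pi * \<i> * of_real (l \<bullet> x))))"
    using lborel_pair.integrable_snd[OF prod_int] by (simp add: inner_s)
qed

section \<open>Hyperplane families, halfspaces and generic points on lines\<close>

lemma dual_vec_decomposition:
  assumes "x \<noteq> 0"
  shows "{n *\<^sub>R dual_vec x + y | n y. n \<in> N \<and> x \<bullet> y = 0} = {\<xi>. \<xi> \<bullet> x \<in> N}"
proof (intro set_eqI iffI)
  fix \<xi> assume "\<xi> \<in> {n *\<^sub>R dual_vec x + y | n y. n \<in> N \<and> x \<bullet> y = 0}"
  then obtain n y where "\<xi> = n *\<^sub>R dual_vec x + y" "n \<in> N" "x \<bullet> y = 0"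
    by blast
  \<comment> \<open>\<open>dual_vec x\<close> has inner product 1 with \<open>x\<close>, so the
    coefficient \<open>n\<close> is recovered as \<open>\<xi> \<bullet> x\<close>.\<close>
  moreover from this have "\<xi> \<bullet> x = n"
    using assms by (simp add: dual_vec_def inner_add_left inner_add_right power2_norm_eq_inner inner_commute)
  ultimately show "\<xi> \<in> {\<xi>. \<xi> \<bullet> x \<in> N}"
    by simp
next
  fix \<xi> assume "\<xi> \<in> {\<xi>. \<xi> \<bullet> x \<in> N}"
  moreover have "x \<bullet> (\<xi> - (\<xi> \<bullet> x) *\<^sub>R dual_vec x) = 0"
    using assms by (simp add: dual_vec_def inner_diff_right inner_commute power2_norm_eq_inner)
  ultimately show "\<xi> \<in> {n *\<^sub>R dual_vec x + y | n y. n \<in> N \<and> x \<bullet> y = 0}"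
    by (intro CollectI exI[of _ "\<xi> \<bullet> x"] exI[of _ "\<xi> - (\<xi> \<bullet> x) *\<^sub>R dual_vec x"]) simp
qed

lemma hyperplanes_iff: "\<xi> \<in> hyperplanes x \<longleftrightarrow> x = 0 \<or> \<xi> \<bullet> x \<in> \<int>"
proof (cases "x = 0")
  case True
  have "\<xi> = 0 *\<^sub>R dual_vec x + \<xi>"
    by simp
  then show ?thesis
    unfolding hyperplanes_def mem_Collect_eq using True by (metis Ints_0 inner_zero_left)
next
  case False
  then show ?thesis
    unfolding hyperplanes_def dual_vec_decomposition[OF False] by simp
qed

lemma hyperplanes_nz_iff: "\<xi> \<in> hyperplanes_nz x \<longleftrightarrow> x = 0 \<or> \<xi> \<bullet> x \<in> \<int> - {0}"
proof (cases "x = 0")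
  case True
  have "\<xi> = 1 *\<^sub>R dual_vec x + \<xi>"
    by (simp add: True dual_vec_def)
  then show ?thesis
    unfolding hyperplanes_nz_def using True by (auto intro!: exI[of _ 1])
next
  case False
  then show ?thesis
    unfolding hyperplanes_nz_def dual_vec_decomposition[OF False] by simp
qed

lemma polyhedron_halfspaces:
  assumes "polyhedron P"
  obtains H where "finite H" "\<forall>(w, c)\<in>H. w \<noteq> 0" "P = {x. \<forall>(w, c)\<in>H. w \<bullet> x \<le> c}"
proof -
  obtain F where F: "finite F" "P = \<Inter> F" "\<forall>h\<in>F. \<exists>a b. a \<noteq> 0 \<and> h = {x. a \<bullet> x \<le> b}"
    using assms unfolding polyhedron_def by blast
  then obtain a b where ab: "\<And>h. h \<in> F \<Longrightarrow> a h \<noteq> 0 \<and> h = {x. a h \<bullet> x \<le> b h}"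
    by metis
  show ?thesis
  proof (rule that[of "(\<lambda>h. (a h, b h)) ` F"])
    have "x \<in> h \<longleftrightarrow> a h \<bullet> x \<le> b h" if "h \<in> F" for h x
      using ab[OF that] by blast
    then show "P = {x. \<forall>(w, c)\<in>(\<lambda>h. (a h, b h)) ` F. w \<bullet> x \<le> c}"
      unfolding F(2) by auto
  qed (use F(1) ab in auto)
qed

lemma not_subset_hyperplane:
  fixes P :: "'a::euclidean_space set"
  assumes "emeasure lborel P > 0" "n \<noteq> 0"
  shows "\<not> P \<subseteq> {x. n \<bullet> x = d}"
proof
  assume sub: "P \<subseteq> {x. n \<bullet> x = d}"
  have "negligible {x. n \<bullet> x = d}"
    using assms(2) by (simp add: negligible_hyperplane)
  moreover have borel: "{x. n \<bullet> x = d} \<in> sets borel"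
    by (intro borel_closed closed_hyperplane)
  ultimately have "emeasure lborel {x. n \<bullet> x = d} = 0"
    by (simp add: negligible_iff_emeasure0)
  then show False
    using emeasure_mono[OF sub, of lborel] assms(1) borel by simp
qed

text \<open>A hyperplane not parallel to \<open>e\<close> meets a line in direction \<open>e\<close>
  at one parameter only, and there are countably many translated hyperplanes.\<close>

lemma AE_line_generic:
  fixes \<rho> e :: "'a::euclidean_space"
  assumes "countable L" "finite H"
  shows "AE u in lborel. \<forall>l\<in>L. generic H e (\<rho> + u *\<^sub>R e - l)"
proof (rule AE_ball_countable'[OF _ assms(1)])
  fix l
  have "AE u in lborel. \<forall>h\<in>H. fst h \<bullet> e \<noteq> 0 \<longrightarrow> fst h \<bullet> (\<rho> + u *\<^sub>R e - l) \<noteq> snd h"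
  proof (rule AE_ball_countable'[OF _ countable_finite[OF assms(2)]])
    fix h
    have "AE u in lborel. u \<noteq> (snd h - fst h \<bullet> (\<rho> - l)) / (fst h \<bullet> e)"
      by (rule AE_lborel_singleton)
    then show "AE u in lborel. fst h \<bullet> e \<noteq> 0 \<longrightarrow> fst h \<bullet> (\<rho> + u *\<^sub>R e - l) \<noteq> snd h"
    proof eventually_elim
      case (elim u)
      then show ?case
        by (auto simp: inner_add_right inner_diff_right field_simps)
    qed
  qed
  then show "AE u in lborel. generic H e (\<rho> + u *\<^sub>R e - l)"
    by eventually_elim (auto simp: generic_def)
qed

text \<open>The transform of the signed leg measure in factored form. That measure is the leg at
  \<open>p\<close>, parametrised over the unit interval and thus of mass 1, convolved with the
  differences of unit masses at 0 and \<open>\<tau>\<^sub>1\<close> and at 0 and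
  \<open>\<tau>\<^sub>2\<close>.\<close>

definition frame_symbol :: "'a::euclidean_space \<Rightarrow> 'a \<Rightarrow> 'a \<Rightarrow> 'a \<Rightarrow> 'a \<Rightarrow> complex" where
  "frame_symbol p e \<tau>\<^sub>1 \<tau>\<^sub>2 x =
    (1 - exp (- (2 * of_real pi * \<i> * of_real (x \<bullet> \<tau>\<^sub>1)))) *
    (1 - exp (- (2 * of_real pi * \<i> * of_real (x \<bullet> \<tau>\<^sub>2)))) *
    exp (- (2 * of_real pi * \<i> * of_real (x \<bullet> p))) * sinc_entire (of_real (x \<bullet> e))"

lemma smooth_frame_symbol: "smooth (frame_symbol p e \<tau>\<^sub>1 \<tau>\<^sub>2)"
proof -
  have h: "(\<lambda>z. 1 - exp (- (2 * of_real pi * \<i> * z))) holomorphic_on UNIV"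
    "(\<lambda>z. exp (- (2 * of_real pi * \<i> * z))) holomorphic_on UNIV"
    by (auto intro!: holomorphic_intros)
  show ?thesis
    unfolding frame_symbol_def[abs_def]
    by (intro smooth_mult smooth_entire[OF h(1)] smooth_entire[OF h(2)] smooth_entire[OF sinc_entire_holomorphic])
qed

lemma frame_symbol_nonzero:
  assumes "\<xi> \<notin> hyperplanes_nz e \<union> hyperplanes \<tau>\<^sub>1 \<union> hyperplanes \<tau>\<^sub>2"
  shows "frame_symbol p e \<tau>\<^sub>1 \<tau>\<^sub>2 \<xi> \<noteq> 0"
  using assms sinc_entire_nonzero exp_character_eq_1_iff
  by (auto simp: frame_symbol_def hyperplanes_iff hyperplanes_nz_iff)

text \<open>Expanding the two differences in the symbol gives four characters at the base points of
  the legs with signs \<open>+ - - +\<close>, and each becomes one segment average of the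
  transform.\<close>

lemma fourier_mult_frame_symbol:
  fixes \<psi> :: "'a::euclidean_space \<Rightarrow> complex" and e :: 'a
  assumes test: "test_function_on U \<psi>"
  defines "S \<equiv> \<lambda>l q. LINT s|lborel. indicator {0..1::real} s *\<^sub>R fourier \<psi> (l + q + s *\<^sub>R e)"
  shows "fourier (\<lambda>x. \<psi> x * frame_symbol p e \<tau>\<^sub>1 \<tau>\<^sub>2 x) l =
    S l p - S l (p + \<tau>\<^sub>1) - S l (p + \<tau>\<^sub>2) + S l (p + \<tau>\<^sub>2 + \<tau>\<^sub>1)"
proof -
  let ?\<chi> = "\<lambda>t. exp (- (2 * of_real pi * \<i> * of_real t)) :: complex"
  let ?T = "\<lambda>q x. \<psi> x * ?\<chi> (x \<bullet> q) * sinc_entire (of_real (x \<bullet> e)) * ?\<chi> (l \<bullet> x)"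
  have S: "S l q = (LINT x|lborel. ?T q x)" and int: "integrable lborel (?T q)" for q
    unfolding S_def using fourier_mult_segment[OF test, where l = l and q = q and e = e]
    by (simp_all add: fourier_def)
  have \<chi>_add: "?\<chi> (s + t) = ?\<chi> s * ?\<chi> t" for s t
    by (simp add: exp_add[symmetric] algebra_simps)
  have "\<psi> x * frame_symbol p e \<tau>\<^sub>1 \<tau>\<^sub>2 x * ?\<chi> (l \<bullet> x) =
      ?T p x - ?T (p + \<tau>\<^sub>1) x - ?T (p + \<tau>\<^sub>2) x + ?T (p + \<tau>\<^sub>2 + \<tau>\<^sub>1) x" for x
    unfolding frame_symbol_def inner_add_right \<chi>_add by (simp only: algebra_simps mult_1 mult_1_right)
  then have "fourier (\<lambda>x. \<psi> x * frame_symbol p e \<tau>\<^sub>1 \<tau>\<^sub>2 x) l =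
      (LINT x|lborel. ?T p x - ?T (p + \<tau>\<^sub>1) x - ?T (p + \<tau>\<^sub>2) x + ?T (p + \<tau>\<^sub>2 + \<tau>\<^sub>1) x)"
    by (simp only: fourier_def)
  also have "\<dots> = S l p - S l (p + \<tau>\<^sub>1) - S l (p + \<tau>\<^sub>2) + S l (p + \<tau>\<^sub>2 + \<tau>\<^sub>1)"
    unfolding S by (simp only: Bochner_Integration.integral_diff Bochner_Integration.integral_add int
        Bochner_Integration.integrable_diff Bochner_Integration.integrable_add)
  finally show ?thesis .
qed

lemma frame_excludes_from_support:
  fixes P :: "'a::euclidean_space set"
  assumes dim: "DIM('a) = 3" and poly: "polytope P" and k: "k > 0"
    and disc: "discrete {l. m l > 0}" and tiles: "multi_tiles P k m"
    and frame: "four_legged_frame P e \<tau>\<^sub>1 \<tau>\<^sub>2"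
    and \<xi>: "\<xi> \<notin> hyperplanes_nz e \<union> hyperplanes \<tau>\<^sub>1 \<union> hyperplanes \<tau>\<^sub>2"
  shows "\<xi> \<notin> support_dist (fourier_dist (delta_dist m))"
proof -
  have cpt: "compact P"
    using poly by (rule polytope_imp_compact)
  have cnt: "countable {l. m l > 0}"
    using disc by (rule countable_discrete)
  have pos: "emeasure lborel P > 0"
    using tiles k cnt borel_compact[OF cpt] by (rule multi_tiles_emeasure_pos)
  have summ: "(\<lambda>l. of_nat (m l) * decay l) summable_on UNIV"
    using tiles pos cpt by (rule multi_tiles_summable_decay)
  have fin: "finite {l. m l > 0 \<and> norm (y - l) \<le> R}" for y R
    using summ by (rule summable_decay_locally_finite)
  obtain R where R: "P \<subseteq> cball 0 R"
    using compact_imp_bounded[OF cpt] unfolding bounded_iff by (metis mem_cball_0 subsetI)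
  obtain H where H: "finite H" "\<forall>(w, c)\<in>H. w \<noteq> 0" and P: "P = {x. \<forall>(w, c)\<in>H. w \<bullet> x \<le> c}"
    using polyhedron_halfspaces[OF polytope_imp_polyhedron[OF poly]] by blast
  have full: "\<forall>n d. n \<noteq> 0 \<longrightarrow> \<not> P \<subseteq> {x. n \<bullet> x = d}"
    using not_subset_hyperplane[OF pos] by blast
  \<comment> \<open>Frames with \<open>\<tau>\<^sub>1 = 0\<close> do not reach this point:
    \<open>hyperplanes 0\<close> is the whole space and cannot be avoided by
    \<open>\<xi>\<close>.\<close>
  have \<tau>: "\<tau>\<^sub>1 \<noteq> 0"
    using \<xi> by (auto simp: hyperplanes_iff)
  show ?thesis
  proof (rule four_legged_frame_sum_eq_0[OF dim poly tiles fin R H P full frame \<tau>])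
    fix p
    assume sum0: "\<And>x. (\<And>l. m l > 0 \<Longrightarrow> generic H e (x - l)) \<Longrightarrow>
      (\<Sum>l | m l > 0 \<and> norm (x - l) \<le> R + 2. real (m l) *
      (indicator (closed_segment p (p + e)) (x - l)
        - indicator (closed_segment (p + \<tau>\<^sub>1) (p + \<tau>\<^sub>1 + e)) (x - l)
        - indicator (closed_segment (p + \<tau>\<^sub>2) (p + \<tau>\<^sub>2 + e)) (x - l)
        + indicator (closed_segment (p + \<tau>\<^sub>2 + \<tau>\<^sub>1) (p + \<tau>\<^sub>2 + \<tau>\<^sub>1 + e)) (x - l))) = 0"
      and e: "e \<noteq> 0"
      and segs: "closed_segment p (p + e) \<union> closed_segment (p + \<tau>\<^sub>1) (p + \<tau>\<^sub>1 + e)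
      \<union> closed_segment (p + \<tau>\<^sub>2) (p + \<tau>\<^sub>2 + e) \<union> closed_segment (p + \<tau>\<^sub>2 + \<tau>\<^sub>1) (p + \<tau>\<^sub>2 + \<tau>\<^sub>1 + e) \<subseteq> P"
    define g where "g = frame_symbol p e \<tau>\<^sub>1 \<tau>\<^sub>2"
    define B where "B = {x. \<exists>l\<in>{l. m l > 0}. \<not> generic H e (x - l)}"
    define J where "J = {0, 1, 2, 3::nat}"
    define q where "q j = [p, p + \<tau>\<^sub>1, p + \<tau>\<^sub>2, p + \<tau>\<^sub>2 + \<tau>\<^sub>1] ! j" for j
    define \<epsilon> where "\<epsilon> j = [1, - 1, - 1, 1 :: real] ! j" for j
    have sum_J: "(\<Sum>j\<in>J. F j) = F 0 + F 1 + F 2 + F 3" for F :: "nat \<Rightarrow> 'b::comm_monoid_add"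
      by (simp add: J_def ac_simps)
    have q_simps: "q 0 = p" "q 1 = p + \<tau>\<^sub>1" "q 2 = p + \<tau>\<^sub>2" "q 3 = p + \<tau>\<^sub>2 + \<tau>\<^sub>1"
      and \<epsilon>_simps: "\<epsilon> 0 = 1" "\<epsilon> 1 = - 1" "\<epsilon> 2 = - 1" "\<epsilon> 3 = 1"
      by (simp_all add: q_def \<epsilon>_def numeral_2_eq_2 numeral_3_eq_3)
    have vanish: "delta_dist m (fourier \<phi>) = 0" if \<phi>: "test_function_on {x. g x \<noteq> 0} \<phi>" for \<phi>
    proof -
      define \<psi> where "\<psi> x = \<phi> x / g x" for x
      have g0: "g x \<noteq> 0" if "x \<in> closure {x. \<phi> x \<noteq> 0}" for x
        using \<phi> that unfolding test_function_on_def by blast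
      have "smooth \<psi>"
        unfolding \<psi>_def using \<phi> g0 smooth_frame_symbol
        by (intro smooth_divide) (auto simp: test_function_on_def g_def)
      moreover have "\<psi> x = 0" if "x \<notin> closure {x. \<phi> x \<noteq> 0}" for x
        using test_function_eq_0[OF that] by (simp add: \<psi>_def)
      ultimately have \<psi>: "test_function_on {x. g x \<noteq> 0} \<psi>"
        by (rule test_function_intro[OF \<phi>])
      have \<phi>_eq: "\<phi> x = \<psi> x * g x" for x
        using g0[of x] test_function_eq_0[of x \<phi>] by (cases "g x = 0") (auto simp: \<psi>_def)
      have expand: "fourier \<phi> l = (\<Sum>j\<in>J. of_real (\<epsilon> j) *
          (LINT s|lborel. indicator {0..1} s *\<^sub>R fourier \<psi> (l + q j + s *\<^sub>R e)))" for l
        unfolding \<phi>_eq[abs_def] g_def fourier_mult_frame_symbol[OF \<psi>] sum_J q_simps \<epsilon>_simps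
        by simp
      obtain K where K: "K \<ge> 0" "\<And>x. norm (fourier \<psi> x) \<le> K * decay x"
        using fourier_decay[OF \<psi>] by blast
      have "(\<Sum>\<^sub>\<infinity>l. of_nat (m l) * (\<Sum>j\<in>J. of_real (\<epsilon> j) *
          (LINT s|lborel. indicator {0..1} s *\<^sub>R fourier \<psi> (l + q j + s *\<^sub>R e)))) = 0"
      proof (rule signed_segments_sum_eq_0[OF e borel_measurable_fourier[OF \<psi>] K summ cnt])
        show "finite J"
          by (simp add: J_def)
        show "closed_segment (q j) (q j + e) \<subseteq> cball 0 (R + 2)" if "j \<in> J" for j
        proof -
          have "closed_segment (q j) (q j + e) \<subseteq> P"
            using that segs unfolding J_def by (auto simp: q_simps[unfolded One_nat_def])
          also have "P \<subseteq> cball 0 (R + 2)"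
            using R by auto
          finally show ?thesis .
        qed
        show "AE u in lborel. \<rho> + u *\<^sub>R e \<notin> B" for \<rho>
          using AE_line_generic[OF cnt H(1), of e \<rho>] by eventually_elim (auto simp: B_def)
        show "(\<Sum>l | m l > 0 \<and> norm (x - l) \<le> R + 2. real (m l) *
            (\<Sum>j\<in>J. \<epsilon> j * indicator (closed_segment (q j) (q j + e)) (x - l))) = 0" if "x \<notin> B" for x
        proof -
          have "generic H e (x - l)" if "m l > 0" for l
            using \<open>x \<notin> B\<close> that unfolding B_def by blast
          from sum0[OF this] show ?thesis
            by (simp add: sum_J q_simps \<epsilon>_simps del: One_nat_def)
        qed
      qed
      then show ?thesis
        by (simp add: delta_dist_def expand)
    qed
    have "open {x. g x \<noteq> 0}"
      unfolding g_def
      by (intro open_Collect_neq continuous_on_const smooth_continuous_on smooth_frame_symbol)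
    moreover have "\<xi> \<in> {x. g x \<noteq> 0}"
      using frame_symbol_nonzero[OF \<xi>] by (simp add: g_def)
    ultimately show ?thesis
      unfolding support_dist_def fourier_dist_def using vanish by blast
  qed
qed

theorem theorem4p1:
  fixes P :: "(real ^ 3) set" and k :: nat and m :: "real ^ 3 \<Rightarrow> nat"
  assumes "polytope P"
    and "centrally_symmetric P"
    and "\<And>F. F facet_of P \<Longrightarrow> centrally_symmetric F"
    and "k > 0"
    and "discrete {l. m l > 0}"
    and "multi_tiles P k m"
  shows "support_dist (fourier_dist (delta_dist m)) \<subseteq>
    {0} \<union> (\<Inter>(e, \<tau>\<^sub>1, \<tau>\<^sub>2) \<in> {(e, \<tau>\<^sub>1, \<tau>\<^sub>2). four_legged_frame P e \<tau>\<^sub>1 \<tau>\<^sub>2}.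
      hyperplanes_nz e \<union> hyperplanes \<tau>\<^sub>1 \<union> hyperplanes \<tau>\<^sub>2)"
proof -
  have "DIM(real ^ 3) = 3"
    by simp
  from frame_excludes_from_support[OF this assms(1,4,5,6)] show ?thesis
    by blast
qed

end
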